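(* Define the following $K_w+2$ rate-memory pairs $(R_t, M_t)$, $t=0,1,\ldots,K_w+1$: (i) $R_0 := F\left(\frac{K_w}{1-\delta_w}+\frac{K_s}{1-\delta_s}\right)^{-1}$, $M_0 := 0$; (ii) for each $t\in\{1,\ldots,K_w\}$: $$R_t := \frac{F(1-\delta_w)\left(1+\frac{K_w-t+1}{tK_s}\cdot\frac{\delta_w-\delta_s}{1-\delta_w}\right)}{\frac{K_w-t+1}{t}\left(1+\frac{K_w-t}{(t+1)K_s}\cdot\frac{\delta_w-\delta_s}{1-\delta_w}\right)+K_s\frac{1-\delta_w}{1-\delta_s}},$$ $$M_t := R_t\,\frac{D}{K_w}\left(t-\left(1+\frac{K_w-t+1}{tK_s}\cdot\frac{\delta_w-\delta_s}{1-\delta_w}\right)^{-1}\right);$$ (iii) $R_{K_w+1} := F\frac{1-\delta_s}{K_s}$, $M_{K_w+1} := DF\frac{1-\delta_s}{K_s}$. Then the capacity-memory tradeoff satisfies $$C(M)\ \geq\ \text{upper convex hull}\big\{(R_t,M_t)\colon t=0,1,\ldots,K_w+1\big\}.$$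
   Context: Consider a memoryless packet-erasure broadcast channel with input alphabet $\{0,1\}^F$ (packets of $F$ bits) and output alphabet $\{0,1\}^F\cup\{\Delta\}$ at each of $K=K_w+K_s$ receivers, where receiver $k$ receives the input packet with probability $1-\delta_k$ and the erasure symbol $\Delta$ with probability $\delta_k$. There are $K_w$ weak receivers, each with erasure probability $\delta_w$ and each equipped with a cache memory of $nM$ bits, and $K_s$ strong receivers, each with erasure probability $\delta_s$, $0<\delta_s\le\delta_w\le 1$, and no cache memory. A transmitter has a library of $D\ge K$ independent messages $W_1,\ldots,W_D$, each uniformly distributed over $\{1,\ldots,\lfloor 2^{nR}\rfloor\}$. In an error-free caching phase, before the demands are known, each weak receiver $i$ stores $V_i=g_i(W_1,\ldots,W_D)\in\{1,\ldots,\lfloor 2^{nM}\rfloor\}$. In the delivery phase, each receiver $k$ demands one message $W_{d_k}$, where the demand vector $(d_1,\ldots,d_K)$ can be any element of $\{1,\ldots,D\}^K$ and is known to the transmitter and all receivers; the transmitter sends a length-$n$ codeword depending on the demand vector and the library, weak receivers decode from their channel outputs and cache contents, strong receivers from their channel outputs only. A pair $(R,M)$ is achievable if the worst-case (over all demand vectors) probability that some receiver decodes its demanded message incorrectly can be made arbitrarily small for sufficiently large $n$. The capacity-memory tradeoff $C(M)$ is the supremum of all rates $R$ such that $(R,M)$ is achievable.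
   Formalization: The case δ_w = 1 is excluded, and K_s ≥ 1 is assumed, because the formulas for R_t and M_t divide by 1−δ_w and by K_s; erasures are taken independent across receivers. *)

theory Defs
  imports "HOL-Analysis.Analysis" "HOL-Library.Extended_Real"
begin

text \<open>Receivers are indexed 0..<K with K = Kw + Ks; receivers k < Kw are the weak ones
  (erasure probability dw, cache of nM bits), receivers Kw <= k < K are the strong ones
  (erasure probability ds, no cache). Packets are bit lists of length F; an erasure is None.
  Messages are indexed 0..<D, a library is a function W with W j in {1..floor(2^(nR))}.\<close>

definition erasure_prob :: "nat \<Rightarrow> real \<Rightarrow> real \<Rightarrow> nat \<Rightarrow> real" where
  "erasure_prob Kw dw ds k = (if k < Kw then dw else ds)"

definition msg_size :: "nat \<Rightarrow> real \<Rightarrow> nat" where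
  "msg_size n R = nat \<lfloor>2 powr (real n * R)\<rfloor>"

definition libraries :: "nat \<Rightarrow> nat \<Rightarrow> real \<Rightarrow> (nat \<Rightarrow> nat) set" where
  "libraries D n R = PiE {..<D} (\<lambda>_. {1..msg_size n R})"

text \<open>Erasure pattern: e (k,t) = True iff receiver k's t-th channel output is erased.\<close>
definition erasure_patterns :: "nat \<Rightarrow> nat \<Rightarrow> (nat \<times> nat \<Rightarrow> bool) set" where
  "erasure_patterns K n = PiE ({..<K} \<times> {..<n}) (\<lambda>_. UNIV)"

definition erasure_weight ::
  "nat \<Rightarrow> real \<Rightarrow> real \<Rightarrow> nat \<Rightarrow> nat \<Rightarrow> (nat \<times> nat \<Rightarrow> bool) \<Rightarrow> real" where
  "erasure_weight Kw dw ds K n e =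
     (\<Prod>k<K. \<Prod>t<n. if e (k, t) then erasure_prob Kw dw ds k else 1 - erasure_prob Kw dw ds k)"

definition channel_output ::
  "nat \<Rightarrow> (nat \<Rightarrow> bool list) \<Rightarrow> (nat \<times> nat \<Rightarrow> bool) \<Rightarrow> nat \<Rightarrow> nat \<Rightarrow> bool list option" where
  "channel_output n x e k = (\<lambda>t. if t < n \<and> \<not> e (k, t) then Some (x t) else None)"

definition valid_demand :: "nat \<Rightarrow> nat \<Rightarrow> (nat \<Rightarrow> nat) \<Rightarrow> bool" where
  "valid_demand K D d \<longleftrightarrow> (\<forall>k<K. d k < D)"

text \<open>Worst-case-relevant error probability for a fixed demand vector d of a code
  (cache, enc, dec): probability (uniform library, independent erasures) that some receiver
  decodes its demanded message incorrectly. Strong receivers get a constant (0) instead of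
  a cache content, i.e. they decode from channel outputs only.\<close>
definition error_prob ::
  "nat \<Rightarrow> nat \<Rightarrow> real \<Rightarrow> real \<Rightarrow> nat \<Rightarrow> nat \<Rightarrow> real
   \<Rightarrow> (nat \<Rightarrow> (nat \<Rightarrow> nat) \<Rightarrow> nat)
   \<Rightarrow> ((nat \<Rightarrow> nat) \<Rightarrow> (nat \<Rightarrow> nat) \<Rightarrow> nat \<Rightarrow> bool list)
   \<Rightarrow> (nat \<Rightarrow> (nat \<Rightarrow> nat) \<Rightarrow> (nat \<Rightarrow> bool list option) \<Rightarrow> nat \<Rightarrow> nat)
   \<Rightarrow> (nat \<Rightarrow> nat) \<Rightarrow> real" where
  "error_prob Kw Ks dw ds D n R cache enc dec d =
     (\<Sum>W\<in>libraries D n R. \<Sum>e\<in>erasure_patterns (Kw + Ks) n.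
        (1 / real (card (libraries D n R))) * erasure_weight Kw dw ds (Kw + Ks) n e *
        (if (\<exists>k < Kw + Ks. dec k d (channel_output n (enc d W) e k)
                               (if k < Kw then cache k W else 0) \<noteq> W (d k))
         then 1 else 0))"

definition valid_code ::
  "nat \<Rightarrow> nat \<Rightarrow> nat \<Rightarrow> nat \<Rightarrow> nat \<Rightarrow> real \<Rightarrow> real
   \<Rightarrow> (nat \<Rightarrow> (nat \<Rightarrow> nat) \<Rightarrow> nat)
   \<Rightarrow> ((nat \<Rightarrow> nat) \<Rightarrow> (nat \<Rightarrow> nat) \<Rightarrow> nat \<Rightarrow> bool list) \<Rightarrow> bool" where
  "valid_code F Kw Ks D n R M cache enc \<longleftrightarrow>
     (\<forall>i<Kw. \<forall>W\<in>libraries D n R. cache i W \<in> {1..nat \<lfloor>2 powr (real n * M)\<rfloor>}) \<and>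
     (\<forall>d W t. valid_demand (Kw + Ks) D d \<longrightarrow> W \<in> libraries D n R \<longrightarrow> t < n \<longrightarrow>
        length (enc d W t) = F)"

definition achievable ::
  "nat \<Rightarrow> nat \<Rightarrow> nat \<Rightarrow> real \<Rightarrow> real \<Rightarrow> nat \<Rightarrow> real \<Rightarrow> real \<Rightarrow> bool" where
  "achievable F Kw Ks dw ds D R M \<longleftrightarrow> 0 \<le> R \<and>
     (\<forall>\<epsilon>>0. \<exists>N. \<forall>n\<ge>N. \<exists>cache enc dec.
        valid_code F Kw Ks D n R M cache enc \<and>
        (\<forall>d. valid_demand (Kw + Ks) D d \<longrightarrow>
             error_prob Kw Ks dw ds D n R cache enc dec d \<le> \<epsilon>))"

definition capacity_memory ::
  "nat \<Rightarrow> nat \<Rightarrow> nat \<Rightarrow> real \<Rightarrow> real \<Rightarrow> nat \<Rightarrow> real \<Rightarrow> ereal" where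
  "capacity_memory F Kw Ks dw ds D M =
     (SUP R \<in> {R. achievable F Kw Ks dw ds D R M}. ereal R)"

definition Rpt :: "nat \<Rightarrow> nat \<Rightarrow> nat \<Rightarrow> real \<Rightarrow> real \<Rightarrow> nat \<Rightarrow> real" where
  "Rpt F Kw Ks dw ds t =
    (let g = (dw - ds) / (1 - dw) in
     if t = 0 then real F / (real Kw / (1 - dw) + real Ks / (1 - ds))
     else if t \<le> Kw then
       real F * (1 - dw) * (1 + (real Kw - real t + 1) / (real t * real Ks) * g) /
       ((real Kw - real t + 1) / real t *
          (1 + (real Kw - real t) / ((real t + 1) * real Ks) * g)
        + real Ks * (1 - dw) / (1 - ds))
     else real F * (1 - ds) / real Ks)"

definition Mpt :: "nat \<Rightarrow> nat \<Rightarrow> nat \<Rightarrow> real \<Rightarrow> real \<Rightarrow> nat \<Rightarrow> nat \<Rightarrow> real" where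
  "Mpt F Kw Ks dw ds D t =
    (let g = (dw - ds) / (1 - dw) in
     if t = 0 then 0
     else if t \<le> Kw then
       Rpt F Kw Ks dw ds t * real D / real Kw *
         (real t - 1 / (1 + (real Kw - real t + 1) / (real t * real Ks) * g))
     else real D * real F * (1 - ds) / real Ks)"

text \<open>Upper convex hull of the points (Ms t, Rs t), t = 0..N, evaluated at memory M:
  supremum of the rates of convex combinations with memory exactly M
  (-\<infinity> outside the hull's domain).\<close>
definition upper_convex_hull :: "(nat \<Rightarrow> real) \<Rightarrow> (nat \<Rightarrow> real) \<Rightarrow> nat \<Rightarrow> real \<Rightarrow> ereal" where
  "upper_convex_hull Rs Ms N M =
     (SUP l \<in> {l. (\<forall>t\<le>N. 0 \<le> l t) \<and> (\<Sum>t\<le>N. l t) = 1 \<and> (\<Sum>t\<le>N. l t * Ms t) = M}.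
        ereal (\<Sum>t\<le>N. l t * Rs t))"

end

theory Submission
  imports Defs
begin

text \<open>
  Split every message into pieces indexed by the sets \<open>S\<close> of weak receivers; receiver \<open>i\<close> caches the
  pieces with \<open>i \<in> S\<close>. For every \<open>S\<close> a fraction of the channel uses carries the sum over \<open>i \<in> S\<close> of
  the piece \<open>S - {i}\<close> of the message demanded by \<open>i\<close>, jointly encoded with the pieces \<open>S\<close> of the
  messages demanded by the strong receivers. The weak receivers in \<open>S\<close> know the latter from their
  caches, so they only have to resolve the sum at rate \<open>F (1 - \<delta>\<^sub>w)\<close>, while the strong receivers resolve
  everything at rate \<open>F (1 - \<delta>\<^sub>s)\<close>. A random codebook achieves this with error probability
  exponentially small in \<open>n\<close>, for every library, so the payloads need not be uniformly distributed.
  The conditions on the piece rates and time fractions are linear, so convex combinations of the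
  corner points need no separate time-sharing argument. The corner point \<open>t\<close> uses only pieces of sizes
  \<open>t - 1\<close> and \<open>t\<close>, in the ratio for which both decoding conditions of the jobs of size \<open>t\<close> are tight.
\<close>

section \<open>Random codes for the erasure channel\<close>

text \<open>Overwriting column \<open>v\<close> on \<open>T\<close> by an arbitrary word over
  \<open>X\<close> loses nothing, because column \<open>u\<close> still stores the old values. So
  \<open>card X ^ card T\<close> copies of the agreeing codebooks fit injectively among all
  codebooks.\<close>

lemma card_agreeing_codebooks:
  fixes X :: "'x set"
  assumes fin: "finite A" "finite U" "finite X" and T: "T \<subseteq> A" and uv: "u \<in> U" "v \<in> U" "v \<noteq> u"
  shows "card {C \<in> A \<times> U \<rightarrow>\<^sub>E X. \<forall>\<tau>\<in>T. C (\<tau>, v) = C (\<tau>, u)} * card X ^ card T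
    \<le> card (A \<times> U \<rightarrow>\<^sub>E X)"
proof -
  let ?G = "{C \<in> A \<times> U \<rightarrow>\<^sub>E X. \<forall>\<tau>\<in>T. C (\<tau>, v) = C (\<tau>, u)}"
  let ?h = "\<lambda>(C, g). \<lambda>x. if snd x = v \<and> fst x \<in> T then g (fst x) else C x"
  have finT: "finite T" using T fin(1) finite_subset by blast
  have "inj_on ?h (?G \<times> (T \<rightarrow>\<^sub>E X))"
  proof (rule inj_onI)
    fix p p' assume p: "p \<in> ?G \<times> (T \<rightarrow>\<^sub>E X)" and p': "p' \<in> ?G \<times> (T \<rightarrow>\<^sub>E X)" and eq: "?h p = ?h p'"
    obtain C g C' g' where d: "p = (C, g)" "p' = (C', g')" by (cases p, cases p')
    have eq': "(if snd x = v \<and> fst x \<in> T then g (fst x) else C x)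
        = (if snd x = v \<and> fst x \<in> T then g' (fst x) else C' x)" for x
      using fun_cong[OF eq, of x] d by simp
    have "g = g'"
    proof (rule PiE_ext)
      show "g \<in> T \<rightarrow>\<^sub>E X" "g' \<in> T \<rightarrow>\<^sub>E X" using p p' d by auto
      fix \<tau> assume "\<tau> \<in> T" then show "g \<tau> = g' \<tau>" using eq'[of "(\<tau>, v)"] by simp
    qed
    moreover have "C x = C' x" for x
    proof (cases "snd x = v \<and> fst x \<in> T")
      case True
      \<comment> \<open>Position \<open>(fst x, u)\<close> is not overwritten, as \<open>u\<close>
        and \<open>v\<close> differ, and both codebooks repeat its value at
        \<open>(fst x, v)\<close>.\<close>
      then have "C (fst x, u) = C' (fst x, u)" using eq'[of "(fst x, u)"] uv by simp
      moreover have "C (fst x, v) = C (fst x, u)" "C' (fst x, v) = C' (fst x, u)"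
        using True p p' d by auto
      moreover have "x = (fst x, v)" using True by (simp add: prod_eq_iff)
      ultimately show ?thesis by metis
    next
      case False then show ?thesis using eq'[of x] by (simp split: if_splits)
    qed
    ultimately show "p = p'" using d by auto
  qed
  moreover have "?h ` (?G \<times> (T \<rightarrow>\<^sub>E X)) \<subseteq> A \<times> U \<rightarrow>\<^sub>E X"
  proof (rule image_subsetI)
    fix p assume p: "p \<in> ?G \<times> (T \<rightarrow>\<^sub>E X)"
    obtain C g where pCg: "p = (C, g)" by (cases p)
    then have C: "C \<in> A \<times> U \<rightarrow>\<^sub>E X" and g: "g \<in> T \<rightarrow>\<^sub>E X" using p by auto
    show "?h p \<in> A \<times> U \<rightarrow>\<^sub>E X" unfolding pCg
    proof (rule PiE_I)
      fix x assume "x \<in> A \<times> U"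
      then show "?h (C, g) x \<in> X" using PiE_mem[OF C] PiE_mem[OF g] by simp
    next
      fix x assume x: "x \<notin> A \<times> U"
      then have "\<not> (snd x = v \<and> fst x \<in> T)" using T uv by (cases x) auto
      then have "?h (C, g) x = C x" unfolding prod.case by (rule if_not_P)
      then show "?h (C, g) x = undefined" using PiE_arb[OF C x] by (rule trans)
    qed
  qed
  ultimately have "card (?G \<times> (T \<rightarrow>\<^sub>E X)) \<le> card (A \<times> U \<rightarrow>\<^sub>E X)"
    using fin by (intro card_inj_on_le) (auto intro!: finite_PiE)
  then show ?thesis using finT by (simp add: card_cartesian_product card_PiE)
qed

lemma card_bool_lists: "card {xs :: bool list. length xs = F} = 2 ^ F"
  using card_lists_length_eq[of "UNIV :: bool set" F] by simp

lemma finite_bool_lists: "finite {xs :: bool list. length xs = F}"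
  using finite_lists_length_eq[of "UNIV :: bool set" F] by simp

text \<open>A union bound over the rivals in \<open>S\<close>, capped by the trivial bound 1. In the
  application \<open>T\<close> consists of the slots of one job that a receiver gets unerased, and
  \<open>S\<close> of the payloads compatible with its cache.\<close>

lemma confusion_probability:
  fixes F :: nat
  defines "X \<equiv> {xs :: bool list. length xs = F}"
  assumes fin: "finite A" "finite U" and T: "T \<subseteq> A" and uU: "u \<in> U" "S \<subseteq> U"
    and \<rho>: "0 < \<rho>" "\<rho> \<le> 1"
  shows "(\<Sum>C\<in>A \<times> U \<rightarrow>\<^sub>E X. if \<exists>v\<in>S. v \<noteq> u \<and> (\<forall>\<tau>\<in>T. C (\<tau>, v) = C (\<tau>, u)) then 1 else 0)
    \<le> real (card (A \<times> U \<rightarrow>\<^sub>E X)) * (real (card S) powr \<rho> * (2 powr (- (real F * \<rho>))) ^ card T)"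
proof -
  let ?B = "A \<times> U \<rightarrow>\<^sub>E X"
  let ?G = "\<lambda>v. {C \<in> ?B. \<forall>\<tau>\<in>T. C (\<tau>, v) = C (\<tau>, u)}"
  have finX: "finite X" unfolding X_def by (rule finite_bool_lists)
  have finB: "finite ?B" using fin finX by (auto intro!: finite_PiE)
  have finS: "finite S" using uU fin finite_subset by blast
  have cardX: "card X = 2 ^ F" unfolding X_def by (rule card_bool_lists)
  let ?s = "\<Sum>C\<in>?B. if \<exists>v\<in>S. v \<noteq> u \<and> (\<forall>\<tau>\<in>T. C (\<tau>, v) = C (\<tau>, u)) then 1 else (0::real)"
  let ?b = "real (card ?B)" and ?x = "real (card S) * (2 powr (- real F)) ^ card T"
  have le1: "?s \<le> ?b"
    by (rule order_trans[OF sum_mono[of _ _ "\<lambda>_. 1"]]) auto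
  have "?s \<le> (\<Sum>C\<in>?B. \<Sum>v\<in>S - {u}. if \<forall>\<tau>\<in>T. C (\<tau>, v) = C (\<tau>, u) then 1 else 0)"
  proof (rule sum_mono)
    fix C assume "C \<in> ?B"
    show "(if \<exists>v\<in>S. v \<noteq> u \<and> (\<forall>\<tau>\<in>T. C (\<tau>, v) = C (\<tau>, u)) then 1 else (0::real))
      \<le> (\<Sum>v\<in>S - {u}. if \<forall>\<tau>\<in>T. C (\<tau>, v) = C (\<tau>, u) then 1 else 0)"
    proof (cases "\<exists>v\<in>S. v \<noteq> u \<and> (\<forall>\<tau>\<in>T. C (\<tau>, v) = C (\<tau>, u))")
      case True
      then obtain v where v: "v \<in> S - {u}" "\<forall>\<tau>\<in>T. C (\<tau>, v) = C (\<tau>, u)" by blast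
      have "(if \<forall>\<tau>\<in>T. C (\<tau>, v) = C (\<tau>, u) then 1 else (0::real))
        \<le> (\<Sum>v\<in>S - {u}. if \<forall>\<tau>\<in>T. C (\<tau>, v) = C (\<tau>, u) then 1 else 0)"
        by (rule member_le_sum) (use v finS in auto)
      then show ?thesis by (simp only: if_P[OF True] if_P[OF v(2)])
    next
      case False
      show ?thesis unfolding if_not_P[OF False] by (rule sum_nonneg) simp
    qed
  qed
  also have "\<dots> = (\<Sum>v\<in>S - {u}. real (card (?G v)))"
    by (subst sum.swap) (use finB in \<open>auto simp: sum.If_cases Int_def\<close>)
  also have "\<dots> \<le> (\<Sum>v\<in>S - {u}. ?b * (2 powr (- real F)) ^ card T)"
  proof (rule sum_mono)
    fix v assume "v \<in> S - {u}"
    then have "card (?G v) * card X ^ card T \<le> card ?B"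
      using fin finX T uU by (intro card_agreeing_codebooks) auto
    then have "real (card (?G v) * card X ^ card T) \<le> ?b" by (rule of_nat_mono)
    then have "real (card (?G v)) * (2 ^ F) ^ card T \<le> ?b" by (simp only: cardX of_nat_mult of_nat_power of_nat_numeral)
    moreover have "(2 powr (- real F)) ^ card T = 1 / (2 ^ F) ^ card T"
      by (simp add: powr_minus powr_realpow field_simps)
    ultimately show "real (card (?G v)) \<le> ?b * (2 powr (- real F)) ^ card T"
      by (simp only:) (simp add: pos_le_divide_eq)
  qed
  also have "\<dots> = real (card (S - {u})) * (?b * (2 powr (- real F)) ^ card T)" by simp
  also have "\<dots> \<le> real (card S) * (?b * (2 powr (- real F)) ^ card T)"
    by (intro mult_right_mono) (use finS in \<open>auto intro: card_mono\<close>)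
  finally have le2: "?s \<le> ?b * ?x" by (simp add: algebra_simps)
  \<comment> \<open>Gallager's trick: raising the union bound to a small power \<open>\<rho>\<close> keeps the later average over
    the erasures multiplicative and still reaches every rate below capacity as \<open>\<rho>\<close> tends to 0.\<close>
  have min_le: "min 1 ?x \<le> ?x powr \<rho>"
  proof (cases "?x = 0")
    case False
    then have x0: "?x > 0" by (auto simp: zero_less_mult_iff)
    show ?thesis
    proof (cases "?x \<le> 1")
      case True
      have "?x powr 1 \<le> ?x powr \<rho>" by (rule powr_mono') (use True x0 \<rho> in auto)
      then show ?thesis using x0 by (simp add: min_def)
    next
      case False then show ?thesis using \<rho> by (simp add: ge_one_powr_ge_zero min_def)
    qed
  qed simp
  have "?s \<le> ?b * min 1 ?x" using le1 le2 by (simp add: min_def)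
  also have "\<dots> \<le> ?b * ?x powr \<rho>" by (rule mult_left_mono[OF min_le]) simp
  also have "?x powr \<rho> = real (card S) powr \<rho> * (2 powr (- (real F * \<rho>))) ^ card T"
    by (simp add: powr_mult powr_power powr_powr algebra_simps)
  finally show ?thesis .
qed

section \<open>Averaging over the erasures and the error exponent\<close>

lemma erasure_weight_nonneg:
  assumes "0 < ds" "ds \<le> dw" "dw < 1"
  shows "0 \<le> erasure_weight Kw dw ds K n e"
  unfolding erasure_weight_def erasure_prob_def using assms by (auto intro!: prod_nonneg)

text \<open>The weight is a product over independent receiver-slot pairs, so the sum over patterns
  factorises. Each slot of \<open>T\<close> in row \<open>k\<close> contributes
  \<open>\<delta> + (1 - \<delta>) * z\<close>; every other pair sums to 1.\<close>

lemma erasure_weight_generating_function: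
  fixes Kw K n k :: nat and dw ds z :: real
  assumes k: "k < K" and T: "T \<subseteq> {..<n}"
  defines "\<delta> \<equiv> erasure_prob Kw dw ds k"
  shows "(\<Sum>e\<in>erasure_patterns K n. erasure_weight Kw dw ds K n e * z ^ card {\<tau>\<in>T. \<not> e (k, \<tau>)})
    = (\<delta> + (1 - \<delta>) * z) ^ card T"
proof -
  let ?I = "{..<K} \<times> {..<n}"
  let ?f = "\<lambda>i b. (if b then erasure_prob Kw dw ds (fst i) else 1 - erasure_prob Kw dw ds (fst i))
    * (if fst i = k \<and> snd i \<in> T \<and> \<not> b then z else 1)"
  have finT: "finite T" using T finite_subset by blast
  have eq: "erasure_weight Kw dw ds K n e * z ^ card {\<tau>\<in>T. \<not> e (k, \<tau>)} = (\<Prod>i\<in>?I. ?f i (e i))" for e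
  proof -
    have "(\<Prod>i\<in>?I. if fst i = k \<and> snd i \<in> T \<and> \<not> e i then z else 1)
      = (\<Prod>i\<in>Pair k ` {\<tau>\<in>T. \<not> e (k, \<tau>)}. z)"
      by (rule prod.mono_neutral_cong_right) (use k T in auto)
    also have "\<dots> = z ^ card {\<tau>\<in>T. \<not> e (k, \<tau>)}"
      by (simp add: card_image inj_on_def)
    finally show ?thesis
      unfolding prod.distrib erasure_weight_def
      by (simp add: prod.cartesian_product case_prod_unfold)
  qed
  have "(\<Sum>e\<in>erasure_patterns K n. \<Prod>i\<in>?I. ?f i (e i)) = (\<Prod>i\<in>?I. \<Sum>b\<in>UNIV. ?f i b)"
    unfolding erasure_patterns_def by (rule prod_sum_PiE[symmetric]) auto
  also have "\<dots> = (\<Prod>i\<in>?I. if fst i = k \<and> snd i \<in> T then \<delta> + (1 - \<delta>) * z else 1)"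
    by (rule prod.cong) (auto simp: UNIV_bool \<delta>_def)
  also have "\<dots> = (\<Prod>i\<in>Pair k ` T. \<delta> + (1 - \<delta>) * z)"
    by (rule prod.mono_neutral_cong_right) (use k T in auto)
  also have "\<dots> = (\<delta> + (1 - \<delta>) * z) ^ card T"
    by (simp add: card_image inj_on_def)
  finally show ?thesis unfolding eq .
qed

text \<open>At \<open>\<rho> = 0\<close> the function \<open>\<phi>\<close> equals 1 and has
  derivative \<open>- (c * ln 2)\<close>: the rate \<open>F * (1 - \<delta>)\<close> cancels against
  the mean number of received bits, and only the slack \<open>c\<close> remains. Hence a small
  \<open>\<rho>\<close> gives a value below 1. Here \<open>m\<close> stands for the number of slots
  of one job and \<open>n\<close> for the block length.\<close>

lemma erasure_exponent:
  fixes \<delta> c :: real and F :: nat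
  assumes "0 < \<delta>" "\<delta> < 1" "0 < c"
  shows "\<exists>\<rho> r. 0 < \<rho> \<and> \<rho> \<le> 1 \<and> 0 < r \<and> r < 1 \<and> (\<forall>n m. m \<le> n \<longrightarrow>
    2 powr (\<rho> * (real F * (1 - \<delta>) * real m - c * real n))
      * (\<delta> + (1 - \<delta>) * 2 powr (- (real F * \<rho>))) ^ m \<le> r ^ n)"
proof -
  define \<phi> where "\<phi> \<rho> = 2 powr (\<rho> * (real F * (1 - \<delta>) - c)) * (\<delta> + (1 - \<delta>) * 2 powr (- (real F * \<rho>)))" for \<rho> :: real
  have "(\<phi> has_real_derivative - (c * ln 2)) (at 0)"
    unfolding \<phi>_def by (rule derivative_eq_intros refl | simp add: algebra_simps)+
  then obtain h where h: "h > 0" "\<And>x. 0 < x \<Longrightarrow> x < h \<Longrightarrow> \<phi> (0 + x) < \<phi> 0"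
    using DERIV_neg_dec_right[of \<phi> "- (c * ln 2)" 0] assms by auto
  define \<rho> where "\<rho> = min 1 (h / 2)"
  have \<rho>: "0 < \<rho>" "\<rho> \<le> 1" "\<rho> < h" using h by (auto simp: \<rho>_def)
  have lt: "\<phi> \<rho> < 1" using h(2)[OF \<rho>(1,3)] by (simp add: \<phi>_def)
  define a where "a = 2 powr (\<rho> * (real F * (1 - \<delta>))) * (\<delta> + (1 - \<delta>) * 2 powr (- (real F * \<rho>)))"
  have a0: "a > 0" unfolding a_def using assms by (intro mult_pos_pos add_pos_pos) auto
  \<comment> \<open>The slack counts for all \<open>n\<close> channel uses, but the factor
    \<open>a\<close> only for \<open>m \<le> n\<close> of them; \<open>max 1 a\<close> bounds
    \<open>a ^ m\<close> by an \<open>n\<close>-th power.\<close>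
  define r where "r = max 1 a * 2 powr (- (\<rho> * c))"
  have "2 powr (- (\<rho> * c)) < 2 powr 0" using \<rho> assms by (intro powr_less_mono) auto
  moreover have "a * 2 powr (- (\<rho> * c)) = \<phi> \<rho>"
  proof -
    have "2 powr (\<rho> * (real F * (1 - \<delta>) - c)) = 2 powr (\<rho> * (real F * (1 - \<delta>))) * 2 powr (- (\<rho> * c))"
      unfolding powr_add[symmetric] by (simp add: algebra_simps)
    then show ?thesis unfolding a_def \<phi>_def by simp
  qed
  ultimately have r: "0 < r" "r < 1" unfolding r_def using lt by (auto simp: max_def)
  have "2 powr (\<rho> * (real F * (1 - \<delta>) * real m - c * real n))
      * (\<delta> + (1 - \<delta>) * 2 powr (- (real F * \<rho>))) ^ m \<le> r ^ n" if "m \<le> n" for n m :: nat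
  proof -
    have "2 powr (\<rho> * (real F * (1 - \<delta>) * real m - c * real n))
      = (2 powr (\<rho> * (real F * (1 - \<delta>)))) ^ m * (2 powr (- (\<rho> * c))) ^ n"
      by (simp add: powr_power flip: powr_add) (simp add: algebra_simps)
    then have "2 powr (\<rho> * (real F * (1 - \<delta>) * real m - c * real n))
      * (\<delta> + (1 - \<delta>) * 2 powr (- (real F * \<rho>))) ^ m = a ^ m * (2 powr (- (\<rho> * c))) ^ n"
      unfolding a_def by (simp add: power_mult_distrib)
    also have "\<dots> \<le> max 1 a ^ n * (2 powr (- (\<rho> * c))) ^ n"
    proof (intro mult_right_mono)
      have "a ^ m \<le> max 1 a ^ m" using a0 by (intro power_mono) auto
      also have "\<dots> \<le> max 1 a ^ n" by (intro power_increasing that) auto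
      finally show "a ^ m \<le> max 1 a ^ n" .
    qed auto
    finally show ?thesis unfolding r_def by (simp add: power_mult_distrib)
  qed
  then show ?thesis using \<rho> r by blast
qed

section \<open>Existence of a good codebook\<close>

lemma finite_libraries: "finite (libraries D n R)"
  unfolding libraries_def by (auto intro!: finite_PiE)

text \<open>For a fixed erasure pattern only the unerased slots of \<open>T\<close> matter, and the
  collision bound applies to them. Averaging it over the patterns evaluates the generating function
  at \<open>2 powr (- (F * \<rho>))\<close>. \<open>B\<close> stays abstract so that one number can
  bound all receivers and jobs.\<close>

lemma expected_confusion:
  fixes F n K Kw k :: nat and dw ds c \<rho> B :: real
  defines "X \<equiv> {xs :: bool list. length xs = F}"
  assumes del: "0 < ds" "ds \<le> dw" "dw < 1" and k: "k < K" and T: "T \<subseteq> {..<n}"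
    and fin: "finite U" and uU: "u \<in> U" "S \<subseteq> U"
    and \<rho>: "0 < \<rho>" "\<rho> \<le> 1"
    and card: "real (card S) \<le> 2 powr (real F * (1 - erasure_prob Kw dw ds k) * real (card T) - c * real n)"
    and decay: "\<forall>m\<le>n. 2 powr (\<rho> * (real F * (1 - erasure_prob Kw dw ds k) * real m - c * real n))
      * (erasure_prob Kw dw ds k + (1 - erasure_prob Kw dw ds k) * 2 powr (- (real F * \<rho>))) ^ m \<le> B"
  shows "(\<Sum>C\<in>{..<n} \<times> U \<rightarrow>\<^sub>E X. \<Sum>e\<in>erasure_patterns K n. erasure_weight Kw dw ds K n e *
      (if \<exists>v\<in>S. v \<noteq> u \<and> (\<forall>\<tau>\<in>T. \<not> e (k, \<tau>) \<longrightarrow> C (\<tau>, v) = C (\<tau>, u)) then 1 else 0))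
    \<le> real (card ({..<n} \<times> U \<rightarrow>\<^sub>E X)) * B"
proof -
  let ?Cs = "{..<n} \<times> U \<rightarrow>\<^sub>E X" and ?E = "erasure_patterns K n"
  let ?w = "erasure_weight Kw dw ds K n" and ?z = "2 powr (- (real F * \<rho>))"
  let ?\<delta> = "erasure_prob Kw dw ds k"
  let ?bad = "\<lambda>C e. if \<exists>v\<in>S. v \<noteq> u \<and> (\<forall>\<tau>\<in>T. \<not> e (k, \<tau>) \<longrightarrow> C (\<tau>, v) = C (\<tau>, u)) then 1 else (0::real)"
  have "(\<Sum>C\<in>?Cs. \<Sum>e\<in>?E. ?w e * ?bad C e) = (\<Sum>e\<in>?E. ?w e * (\<Sum>C\<in>?Cs. ?bad C e))"
    by (subst sum.swap) (simp add: sum_distrib_left)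
  also have "\<dots> \<le> (\<Sum>e\<in>?E. ?w e * (real (card ?Cs) * (real (card S) powr \<rho> * ?z ^ card {\<tau>\<in>T. \<not> e (k, \<tau>)})))"
  proof (intro sum_mono mult_left_mono)
    fix e
    have "(\<Sum>C\<in>?Cs. ?bad C e)
      = (\<Sum>C\<in>?Cs. if \<exists>v\<in>S. v \<noteq> u \<and> (\<forall>\<tau>\<in>{\<tau>\<in>T. \<not> e (k, \<tau>)}. C (\<tau>, v) = C (\<tau>, u)) then 1 else 0)"
      by (simp add: Ball_def imp_conjL)
    also have "\<dots> \<le> real (card ?Cs) * (real (card S) powr \<rho> * ?z ^ card {\<tau>\<in>T. \<not> e (k, \<tau>)})"
      unfolding X_def by (rule confusion_probability) (use T fin uU \<rho> in auto)
    finally show "(\<Sum>C\<in>?Cs. ?bad C e) \<le> real (card ?Cs) * (real (card S) powr \<rho> * ?z ^ card {\<tau>\<in>T. \<not> e (k, \<tau>)})" .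
  qed (rule erasure_weight_nonneg[OF del])
  also have "\<dots> = real (card ?Cs) * (real (card S) powr \<rho> * (\<Sum>e\<in>?E. ?w e * ?z ^ card {\<tau>\<in>T. \<not> e (k, \<tau>)}))"
    by (simp add: sum_distrib_left mult_ac)
  also have "\<dots> = real (card ?Cs) * (real (card S) powr \<rho> * (?\<delta> + (1 - ?\<delta>) * ?z) ^ card T)"
    by (simp only: erasure_weight_generating_function[OF k T])
  also have "\<dots> \<le> real (card ?Cs) * B"
  proof (intro mult_left_mono)
    have "real (card S) powr \<rho> \<le> (2 powr (real F * (1 - ?\<delta>) * real (card T) - c * real n)) powr \<rho>"
      using card \<rho> by (intro powr_mono2) auto
    then have "real (card S) powr \<rho> \<le> 2 powr (\<rho> * (real F * (1 - ?\<delta>) * real (card T) - c * real n))"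
      by (simp add: powr_powr mult.commute)
    moreover have "0 \<le> (?\<delta> + (1 - ?\<delta>) * ?z) ^ card T"
      using del by (intro zero_le_power add_nonneg_nonneg mult_nonneg_nonneg) (auto simp: erasure_prob_def)
    moreover have "card T \<le> n" using card_mono[OF _ T] by simp
    ultimately show "real (card S) powr \<rho> * (?\<delta> + (1 - ?\<delta>) * ?z) ^ card T \<le> B"
      using decay mult_right_mono order_trans by blast
  qed auto
  finally show ?thesis .
qed

text \<open>Slot \<open>\<tau>\<close> carries the random codeword symbol of the payload of job \<open>slot \<tau>\<close>, and receiver \<open>k\<close>
  listens to the jobs in \<open>A k\<close>. Its cache \<open>V k W\<close> shrinks the set of payloads of a job that it has to
  tell apart, so only the size of that conditional set has to stay below the capacity of receiver \<open>k\<close>.\<close>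

lemma random_coding:
  fixes u :: "'j \<Rightarrow> (nat \<Rightarrow> nat) \<Rightarrow> 'u" and \<rho> :: "nat \<Rightarrow> real" and c B R :: real
    and cache :: "nat \<Rightarrow> (nat \<Rightarrow> nat) \<Rightarrow> nat" and Kw Ks F D n :: nat and dw ds :: real
  defines "V \<equiv> \<lambda>k W. if k < Kw then cache k W else 0"
  defines "K \<equiv> Kw + Ks"
  assumes del: "0 < ds" "ds \<le> dw" "dw < 1"
    and J: "finite J" "\<And>k. k < K \<Longrightarrow> A k \<subseteq> J"
    and lib: "libraries D n R \<noteq> {}"
    and determined: "\<And>k W W'. k < K \<Longrightarrow> W \<in> libraries D n R \<Longrightarrow> W' \<in> libraries D n R \<Longrightarrow>
      V k W' = V k W \<Longrightarrow> (\<And>j. j \<in> A k \<Longrightarrow> u j W' = u j W) \<Longrightarrow> W' (d k) = W (d k)"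
    and count: "\<And>k W j. k < K \<Longrightarrow> W \<in> libraries D n R \<Longrightarrow> j \<in> A k \<Longrightarrow>
      real (card (u j ` {W' \<in> libraries D n R. V k W' = V k W}))
        \<le> 2 powr (real F * (1 - erasure_prob Kw dw ds k) * real (card {\<tau>\<in>{..<n}. slot \<tau> = j}) - c * real n)"
    and \<rho>: "\<And>k. k < K \<Longrightarrow> 0 < \<rho> k" "\<And>k. k < K \<Longrightarrow> \<rho> k \<le> 1"
    and slot: "\<And>\<tau>. \<tau> < n \<Longrightarrow> slot \<tau> \<in> J"
    and decay: "\<And>k. k < K \<Longrightarrow> \<forall>m\<le>n. 2 powr (\<rho> k * (real F * (1 - erasure_prob Kw dw ds k) * real m - c * real n))
      * (erasure_prob Kw dw ds k + (1 - erasure_prob Kw dw ds k) * 2 powr (- (real F * \<rho> k))) ^ m \<le> B"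
    and B: "0 \<le> B"
  shows "\<exists>enc dec. (\<forall>W\<in>libraries D n R. \<forall>\<tau><n. length (enc d W \<tau>) = F) \<and>
    error_prob Kw Ks dw ds D n R cache enc dec d \<le> real K * real (card J) * B"
proof -
  let ?L = "libraries D n R"
  define U where "U = (\<Union>j\<in>J. u j ` ?L)"
  define X where "X = {xs :: bool list. length xs = F}"
  define Cs where "Cs = {..<n} \<times> U \<rightarrow>\<^sub>E X"
  \<comment> \<open>The demand arguments of \<open>enc\<close> and \<open>dec\<close> are ignored:
    this code serves the one fixed demand \<open>d\<close>, which may also enter through
    \<open>u\<close>.\<close>
  define enc where "enc C = (\<lambda>(d :: nat \<Rightarrow> nat) W \<tau>. C (\<tau>, u (slot \<tau>) W) :: bool list)" for C
  \<comment> \<open>The decoder picks any library that matches the cache and all unerased outputs in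
    the slots of the receiver's jobs.\<close>
  define consistent where "consistent C k y v W' \<longleftrightarrow> W' \<in> ?L \<and> V k W' = v \<and>
    (\<forall>\<tau><n. slot \<tau> \<in> A k \<longrightarrow> y \<tau> \<noteq> None \<longrightarrow> y \<tau> = Some (enc C d W' \<tau>))" for C k y v W'
  define dec where "dec C = (\<lambda>k (d' :: nat \<Rightarrow> nat) y v. (SOME W'. consistent C k y v W') (d k))" for C
  define T where "T j = {\<tau>\<in>{..<n}. slot \<tau> = j}" for j
  define S where "S k j W = u j ` {W' \<in> ?L. V k W' = V k W}" for k j W
  define bad where "bad k j W C e = (if \<exists>v\<in>S k j W. v \<noteq> u j W \<and>
    (\<forall>\<tau>\<in>T j. \<not> e (k, \<tau>) \<longrightarrow> C (\<tau>, v) = C (\<tau>, u j W)) then 1 else (0::real))" for k j W and C :: "nat \<times> 'u \<Rightarrow> bool list" and e :: "nat \<times> nat \<Rightarrow> bool"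
  let ?E = "erasure_patterns K n" and ?w = "erasure_weight Kw dw ds K n"
  have finU: "finite U" unfolding U_def using J finite_libraries by auto
  have finX: "finite X" unfolding X_def by (rule finite_bool_lists)
  have finCs: "finite Cs" unfolding Cs_def using finU finX by (auto intro!: finite_PiE)
  have "replicate F True \<in> X" by (simp add: X_def)
  then have neCs: "Cs \<noteq> {}" unfolding Cs_def by (auto simp: PiE_eq_empty_iff)
  have finA: "finite (A k)" "card (A k) \<le> card J" if "k < K" for k
    using J that by (auto intro: finite_subset card_mono)
  \<comment> \<open>The library that was sent is always consistent. If the chosen one differs at
    \<open>d k\<close>, then by \<open>determined\<close> some job has two different payloads with
    the same unerased symbols, so one of the events \<open>bad\<close> occurs.\<close>
  have wrong: "(if \<exists>k<K. dec C k d (channel_output n (enc C d W) e k) (V k W) \<noteq> W (d k) then 1 else 0)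
      \<le> (\<Sum>k<K. \<Sum>j\<in>A k. bad k j W C e)" if W: "W \<in> ?L" for C W e
  proof (cases "\<exists>k<K. dec C k d (channel_output n (enc C d W) e k) (V k W) \<noteq> W (d k)")
    case True
    then obtain k where k: "k < K" and ne: "dec C k d (channel_output n (enc C d W) e k) (V k W) \<noteq> W (d k)" by blast
    let ?y = "channel_output n (enc C d W) e k"
    define W' where "W' = (SOME W'. consistent C k ?y (V k W) W')"
    have "consistent C k ?y (V k W) W"
      unfolding consistent_def channel_output_def using W by auto
    then have W': "consistent C k ?y (V k W) W'" unfolding W'_def by (rule someI[of "consistent C k ?y (V k W)"])
    then have WL: "W' \<in> ?L" "V k W' = V k W" by (auto simp: consistent_def)
    have "W' (d k) \<noteq> W (d k)" using ne unfolding dec_def W'_def .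
    then obtain j where j: "j \<in> A k" "u j W' \<noteq> u j W" using determined[OF k W WL] by blast
    have "C (\<tau>, u j W') = C (\<tau>, u j W)" if "\<tau> \<in> T j" "\<not> e (k, \<tau>)" for \<tau>
      using W' that j unfolding consistent_def channel_output_def T_def enc_def by auto
    then have "bad k j W C e = 1" using WL j unfolding bad_def S_def by auto
    moreover have "bad k j W C e \<le> (\<Sum>j\<in>A k. bad k j W C e)"
      by (rule member_le_sum) (use j finA[OF k] in \<open>auto simp: bad_def\<close>)
    moreover have "(\<Sum>j\<in>A k. bad k j W C e) \<le> (\<Sum>k<K. \<Sum>j\<in>A k. bad k j W C e)"
      by (rule member_le_sum) (use k in \<open>auto simp: bad_def intro!: sum_nonneg\<close>)
    ultimately show ?thesis using True by simp
  qed (auto simp: bad_def intro!: sum_nonneg)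
  have "(\<Sum>C\<in>Cs. error_prob Kw Ks dw ds D n R cache (enc C) (dec C) d)
    \<le> (\<Sum>C\<in>Cs. \<Sum>W\<in>?L. \<Sum>e\<in>?E. (1 / real (card ?L)) * ?w e * (\<Sum>k<K. \<Sum>j\<in>A k. bad k j W C e))"
    unfolding error_prob_def K_def[symmetric]
    by (intro sum_mono mult_left_mono order_trans[OF _ wrong] mult_nonneg_nonneg erasure_weight_nonneg[OF del])
      (auto simp: V_def)
  also have "\<dots> = (\<Sum>W\<in>?L. (1 / real (card ?L)) * (\<Sum>k<K. \<Sum>j\<in>A k. \<Sum>C\<in>Cs. \<Sum>e\<in>?E. ?w e * bad k j W C e))"
  proof -
    have "(\<Sum>k<K. \<Sum>j\<in>A k. \<Sum>C\<in>Cs. \<Sum>e\<in>?E. ?w e * bad k j W C e)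
       = (\<Sum>C\<in>Cs. \<Sum>e\<in>?E. ?w e * (\<Sum>k<K. \<Sum>j\<in>A k. bad k j W C e))" for W
    proof -
      have "(\<Sum>C\<in>Cs. \<Sum>e\<in>?E. ?w e * (\<Sum>k<K. \<Sum>j\<in>A k. bad k j W C e))
        = (\<Sum>C\<in>Cs. \<Sum>e\<in>?E. \<Sum>k<K. \<Sum>j\<in>A k. ?w e * bad k j W C e)"
        by (simp add: sum_distrib_left)
      also have "\<dots> = (\<Sum>C\<in>Cs. \<Sum>k<K. \<Sum>e\<in>?E. \<Sum>j\<in>A k. ?w e * bad k j W C e)"
        by (intro sum.cong[OF refl] sum.swap)
      also have "\<dots> = (\<Sum>k<K. \<Sum>C\<in>Cs. \<Sum>e\<in>?E. \<Sum>j\<in>A k. ?w e * bad k j W C e)"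
        by (rule sum.swap)
      also have "\<dots> = (\<Sum>k<K. \<Sum>C\<in>Cs. \<Sum>j\<in>A k. \<Sum>e\<in>?E. ?w e * bad k j W C e)"
        by (intro sum.cong[OF refl] sum.swap)
      also have "\<dots> = (\<Sum>k<K. \<Sum>j\<in>A k. \<Sum>C\<in>Cs. \<Sum>e\<in>?E. ?w e * bad k j W C e)"
        by (intro sum.cong[OF refl] sum.swap)
      finally show ?thesis by simp
    qed
    then show ?thesis
      by (subst sum.swap) (simp add: sum_distrib_left mult.assoc sum_divide_distrib)
  qed
  also have "\<dots> \<le> (\<Sum>W\<in>?L. (1 / real (card ?L)) * (\<Sum>k<K. \<Sum>j\<in>A k. real (card Cs) * B))"
  proof (intro sum_mono mult_left_mono)
    fix W k j assume W: "W \<in> ?L" and "k \<in> {..<K}" and j: "j \<in> A k"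
    then have k: "k < K" by simp
    have uU: "u j W \<in> U" "S k j W \<subseteq> U" using W j J(2)[OF k] unfolding U_def S_def by auto
    show "(\<Sum>C\<in>Cs. \<Sum>e\<in>?E. ?w e * bad k j W C e) \<le> real (card Cs) * B"
      unfolding bad_def Cs_def X_def
      by (rule expected_confusion[OF del k _ finU uU \<rho>[OF k] _ decay[OF k]])
        (use count[OF k W j] in \<open>auto simp: S_def T_def\<close>)
  qed auto
  also have "\<dots> = (\<Sum>k<K. real (card (A k)) * (real (card Cs) * B))"
    using lib finite_libraries by (simp add: card_eq_0_iff sum_distrib_left)
  also have "\<dots> \<le> (\<Sum>k<K. real (card J) * (real (card Cs) * B))"
    by (intro sum_mono mult_right_mono) (use finA B in auto)
  also have "\<dots> = (\<Sum>C\<in>Cs. real K * real (card J) * B)" by simp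
  \<comment> \<open>Some codebook is no worse than the average over all codebooks.\<close>
  finally obtain C where C: "C \<in> Cs" "error_prob Kw Ks dw ds D n R cache (enc C) (dec C) d \<le> real K * real (card J) * B"
    using sum_strict_mono[OF finCs neCs, of "\<lambda>_. real K * real (card J) * B"
        "\<lambda>C. error_prob Kw Ks dw ds D n R cache (enc C) (dec C) d"] by (meson not_le)
  have "length (enc C d W \<tau>) = F" if "W \<in> ?L" "\<tau> < n" for W \<tau>
  proof -
    have "C (\<tau>, u (slot \<tau>) W) \<in> X"
    proof (rule PiE_mem[of C "{..<n} \<times> U" "\<lambda>_. X"])
      show "C \<in> {..<n} \<times> U \<rightarrow>\<^sub>E X" using C(1) by (simp only: Cs_def)
      show "(\<tau>, u (slot \<tau>) W) \<in> {..<n} \<times> U" using that slot[OF that(2)] by (auto simp: U_def)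
    qed
    then show ?thesis by (simp add: enc_def X_def)
  qed
  then show ?thesis using C(2) by blast
qed

section \<open>Coded caching with piggybacking\<close>

text \<open>Each new job takes the last slots still free, and the surplus stays with the job of the
  base case. Extra slots are harmless, since only lower bounds on the slot counts matter.\<close>

lemma slot_allocation:
  fixes m :: "'j \<Rightarrow> nat"
  assumes "finite J" "J \<noteq> {}" "(\<Sum>j\<in>J. m j) \<le> n"
  shows "\<exists>slot. (\<forall>\<tau>. slot \<tau> \<in> J) \<and> (\<forall>j\<in>J. m j \<le> card {\<tau>\<in>{..<n}. slot \<tau> = j})"
  using assms
proof (induction J arbitrary: n rule: finite_ne_induct)
  case (singleton j)
  then show ?case by (intro exI[of _ "\<lambda>_. j"]) auto
next
  case (insert i J)
  then have sum: "m i + (\<Sum>j\<in>J. m j) \<le> n" by simp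
  then have "sum m J \<le> n - m i" by simp
  from insert.IH[OF this] obtain slot where slot: "\<forall>\<tau>. slot \<tau> \<in> J"
    "\<forall>j\<in>J. m j \<le> card {\<tau>\<in>{..<n - m i}. slot \<tau> = j}"
    by blast
  let ?slot = "\<lambda>\<tau>. if \<tau> < n - m i then slot \<tau> else i"
  have "m i = card {n - m i..<n}" using sum by simp
  also have "\<dots> \<le> card {\<tau>\<in>{..<n}. ?slot \<tau> = i}" by (rule card_mono) auto
  finally have "m i \<le> card {\<tau>\<in>{..<n}. ?slot \<tau> = i}" .
  moreover have "m j \<le> card {\<tau>\<in>{..<n}. ?slot \<tau> = j}" if "j \<in> J" for j
  proof -
    have "m j \<le> card {\<tau>\<in>{..<n - m i}. slot \<tau> = j}" using slot that by blast
    also have "\<dots> \<le> card {\<tau>\<in>{..<n}. ?slot \<tau> = j}" by (rule card_mono) auto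
    finally show ?thesis .
  qed
  ultimately show ?case using slot(1) by (intro exI[of _ ?slot]) auto
qed

text \<open>Decoding of the coded-caching sum: \<open>x\<close> is the part of the sum that a
  receiver knows, \<open>a\<close> and \<open>b\<close> are candidates for its missing
  piece.\<close>

lemma mod_add_cancel_small:
  fixes a b x q :: nat
  assumes "a < q" "b < q" "(a + x) mod q = (b + x) mod q"
  shows "a = b"
proof -
  have "a = b" if "a \<le> b" "b < q" "(a + x) mod q = (b + x) mod q" for a b :: nat
  proof -
    have "q dvd (b + x) - (a + x)" using that mod_eq_dvd_iff_nat[of "a + x" "b + x" q] by simp
    then have "q dvd b - a" by simp
    then show ?thesis using that by (metis diff_is_0_eq dvd_imp_le le_antisym less_imp_diff_less linorder_not_less neq0_conv)
  qed
  then show ?thesis using assms by (metis linear)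
qed

text \<open>A message consists of one piece in \<open>{..<q (card S)}\<close> for every set \<open>S\<close> of weak receivers, and
  exactly the members of \<open>S\<close> cache it. There is one job per \<open>S\<close>; below, \<open>X\<close> is its coded-caching sum for
  the members of \<open>S\<close>, and \<open>Y\<close> the pieces with index \<open>S\<close> demanded by the strong receivers, which
  piggyback for free because the members of \<open>S\<close> have them cached. The modulus \<open>qq {} = 1\<close> makes the
  empty sum carry no information.\<close>

lemma coded_caching_code:
  fixes q :: "nat \<Rightarrow> nat" and \<rho> :: "nat \<Rightarrow> real" and slot :: "nat \<Rightarrow> nat set" and c B R M :: real
    and Kw Ks F D n :: nat and dw ds :: real
  defines "P \<equiv> Pow {..<Kw}" and "K \<equiv> Kw + Ks"
  defines "N \<equiv> \<lambda>S. real (card {\<tau>\<in>{..<n}. slot \<tau> = S})"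
  defines "qq \<equiv> \<lambda>S. if S = {} then 1 else q (card S - 1)"
  assumes del: "0 < ds" "ds \<le> dw" "dw < 1"
    and R: "0 \<le> R" and q: "\<And>s. 1 \<le> q s"
    and msg: "msg_size n R \<le> (\<Prod>S\<in>P. q (card S))"
    and mem: "\<And>i. i < Kw \<Longrightarrow> (\<Prod>S\<in>{S\<in>P. i \<in> S}. q (card S)) ^ D \<le> nat \<lfloor>2 powr (real n * M)\<rfloor>"
    and slot: "\<And>\<tau>. slot \<tau> \<in> P"
    and weak: "\<And>S. S \<in> P \<Longrightarrow> S \<noteq> {} \<Longrightarrow> real (qq S) \<le> 2 powr (real F * (1 - dw) * N S - c * real n)"
    and strong: "\<And>S. S \<in> P \<Longrightarrow> real (qq S * q (card S) ^ Ks) \<le> 2 powr (real F * (1 - ds) * N S - c * real n)"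
    and \<rho>: "\<And>k. k < K \<Longrightarrow> 0 < \<rho> k" "\<And>k. k < K \<Longrightarrow> \<rho> k \<le> 1"
    and decay: "\<And>k. k < K \<Longrightarrow> \<forall>m\<le>n. 2 powr (\<rho> k * (real F * (1 - erasure_prob Kw dw ds k) * real m - c * real n))
      * (erasure_prob Kw dw ds k + (1 - erasure_prob Kw dw ds k) * 2 powr (- (real F * \<rho> k))) ^ m \<le> B"
    and B: "0 \<le> B"
  shows "\<exists>cache enc dec. valid_code F Kw Ks D n R M cache enc \<and>
    (\<forall>d. valid_demand K D d \<longrightarrow> error_prob Kw Ks dw ds D n R cache enc dec d \<le> real K * real (2 ^ Kw) * B)"
proof -
  let ?L = "libraries D n R"
  have finP: "finite P" and cardP: "card P = 2 ^ Kw" unfolding P_def by (auto simp: card_Pow)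
  have "1 \<le> 2 powr (real n * R)" using R by (intro ge_one_powr_ge_zero) auto
  then have msg1: "1 \<le> msg_size n R" unfolding msg_size_def by linarith
  have lib: "?L \<noteq> {}" unfolding libraries_def using msg1 by (auto simp: PiE_eq_empty_iff)
  let ?pieces = "\<Pi>\<^sub>E S\<in>P. {..<q (card S)}"
  \<comment> \<open>There may be more piece tuples than messages, so messages are injected into the
    tuples. The pieces are then in general neither uniform nor independent, which the random code
    tolerates.\<close>
  have "card {1..msg_size n R} \<le> card ?pieces" using msg finP by (simp add: card_PiE)
  then obtain emb where emb: "emb ` {1..msg_size n R} \<subseteq> ?pieces" "inj_on emb {1..msg_size n R}"
    using card_le_inj[of "{1..msg_size n R}" ?pieces] finP by (auto intro!: finite_PiE)
  define piece where "piece W j S = emb (W j) S" for W :: "nat \<Rightarrow> nat" and j S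
  have inlib: "W j \<in> {1..msg_size n R}" if "W \<in> ?L" "j < D" for W j
    using PiE_mem[of W "{..<D}" "\<lambda>_. {1..msg_size n R}" j] that unfolding libraries_def by blast
  have piece_lt: "piece W j S < q (card S)" if "W \<in> ?L" "j < D" "S \<in> P" for W j S
  proof -
    have "emb (W j) \<in> ?pieces" using emb inlib[OF that(1,2)] by blast
    from PiE_mem[OF this that(3)] show ?thesis by (simp add: piece_def)
  qed
  define Q where "Q i = {..<D} \<times> {S\<in>P. i \<in> S}" for i :: nat
  let ?contents = "\<lambda>i. \<Pi>\<^sub>E x\<in>Q i. {..<q (card (snd x))}"
  have "\<exists>f. f ` ?contents i \<subseteq> {1..nat \<lfloor>2 powr (real n * M)\<rfloor>} \<and> inj_on f (?contents i)" if "i < Kw" for i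
  proof (rule card_le_inj)
    have finQ: "finite (Q i)" unfolding Q_def using finP by auto
    then show "finite (?contents i)" by (auto intro!: finite_PiE)
    have "card (?contents i) = (\<Prod>x\<in>Q i. q (card (snd x)))" using finQ by (simp add: card_PiE)
    also have "\<dots> = (\<Prod>j<D. \<Prod>S\<in>{S\<in>P. i \<in> S}. q (card S))"
      unfolding Q_def prod.cartesian_product case_prod_unfold ..
    also have "\<dots> = (\<Prod>S\<in>{S\<in>P. i \<in> S}. q (card S)) ^ D" by simp
    finally show "card (?contents i) \<le> card {1..nat \<lfloor>2 powr (real n * M)\<rfloor>}" using mem[OF that] by simp
  qed auto
  then obtain cemb where cemb: "\<And>i. i < Kw \<Longrightarrow> cemb i ` ?contents i \<subseteq> {1..nat \<lfloor>2 powr (real n * M)\<rfloor>}"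
    "\<And>i. i < Kw \<Longrightarrow> inj_on (cemb i) (?contents i)" by metis
  define content where "content i W = restrict (\<lambda>x. piece W (fst x) (snd x)) (Q i)" for i W
  define cache where "cache i W = cemb i (content i W)" for i W
  define V where "V k W = (if k < Kw then cache k W else 0)" for k W
  have content: "content i W \<in> ?contents i" if "W \<in> ?L" for i W
    unfolding content_def using piece_lt[OF that] by (auto simp: Q_def)
  have known: "piece W' j S = piece W j S"
    if "k < Kw" "W \<in> ?L" "W' \<in> ?L" "V k W' = V k W" "j < D" "S \<in> P" "k \<in> S" for k W W' j S
  proof -
    have "content k W' = content k W"
    proof (rule inj_onD[OF cemb(2)[OF that(1)] _ content[OF that(3)] content[OF that(2)]])
      show "cemb k (content k W') = cemb k (content k W)"
        using that(1,4) by (simp add: V_def cache_def)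
    qed
    then have "content k W' (j, S) = content k W (j, S)" by simp
    then show ?thesis using that unfolding content_def Q_def by simp
  qed
  \<comment> \<open>All pieces missing at a weak receiver travel in jobs whose set contains it. In
    the other jobs it could not strip off the piggybacked pieces, so it does not decode
    there.\<close>
  define A where "A k = (if k < Kw then {S\<in>P. k \<in> S} else P)" for k
  define X where "X d W S = (\<Sum>i\<in>S. piece W (d i) (S - {i}))" for d W S
  define Y where "Y d W S = restrict (\<lambda>k. piece W (d k) S) {Kw..<K}" for d W S
  define u where "u d S W = (X d W S mod qq S, Y d W S)" for d S W
  have qq0: "0 < qq S" for S unfolding qq_def using q[of "card S - 1"] by auto
  have code: "\<exists>enc dec. (\<forall>W\<in>?L. \<forall>\<tau><n. length (enc d W \<tau>) = F) \<and>
    error_prob Kw Ks dw ds D n R cache enc dec d \<le> real K * real (card P) * B"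
    if d: "valid_demand K D d" for d
  proof -
    have dD: "d k < D" if "k < K" for k using d that by (simp add: valid_demand_def)
    have message: "W' (d k) = W (d k)"
      if "k < K" "W \<in> ?L" "W' \<in> ?L" "\<And>S. S \<in> P \<Longrightarrow> piece W' (d k) S = piece W (d k) S" for k W W'
    proof -
      have "emb (W' (d k)) = emb (W (d k))"
      proof (rule PiE_ext)
        show "emb (W' (d k)) \<in> ?pieces" "emb (W (d k)) \<in> ?pieces"
          using emb inlib dD that by blast+
      qed (use that(4) in \<open>simp add: piece_def\<close>)
      then show ?thesis using emb(2) inlib dD that by (meson inj_onD)
    qed
    have determined: "W' (d k) = W (d k)"
      if k: "k < K" and W: "W \<in> ?L" "W' \<in> ?L" and V: "V k W' = V k W"
        and u: "\<And>S. S \<in> A k \<Longrightarrow> u d S W' = u d S W" for k W W'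
    proof (rule message[OF k W])
      fix S assume S: "S \<in> P"
      show "piece W' (d k) S = piece W (d k) S"
      proof (cases "k < Kw")
        case False
        then have "Y d W' S k = Y d W S k" using u[of S] S by (simp add: A_def u_def)
        then show ?thesis using False k by (simp add: Y_def)
      next
        case True
        show ?thesis
        proof (cases "k \<in> S")
          case True
          then show ?thesis using known[OF \<open>k < Kw\<close> W V dD[OF k] S] by simp
        next
          case False
          \<comment> \<open>The missing piece \<open>S\<close> travels in the sum of the job
            \<open>insert k S\<close>. Every other summand has \<open>k\<close> in its index and is
            therefore cached.\<close>
          let ?T = "insert k S"
          have T: "?T \<in> P" using S True by (auto simp: P_def)
          have finS: "finite S" using S unfolding P_def by (auto intro: finite_subset)
          have X: "X d Z ?T = piece Z (d k) S + (\<Sum>i\<in>S. piece Z (d i) (?T - {i}))" for Z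
            unfolding X_def using False finS by simp
          have rest: "(\<Sum>i\<in>S. piece W' (d i) (?T - {i})) = (\<Sum>i\<in>S. piece W (d i) (?T - {i}))"
          proof (rule sum.cong[OF refl])
            fix i assume i: "i \<in> S"
            then have "i < Kw" using S by (auto simp: P_def)
            then show "piece W' (d i) (?T - {i}) = piece W (d i) (?T - {i})"
              using i False T by (intro known[OF True W V dD]) (auto simp: P_def K_def)
          qed
          have eq: "X d W' ?T mod qq ?T = X d W ?T mod qq ?T"
            using u[of ?T] T True by (simp add: A_def u_def)
          \<comment> \<open>The modulus of the job equals the alphabet size of the missing piece, so
            the residue determines it.\<close>
          have qT: "qq ?T = q (card S)" using False finS by (simp add: qq_def)
          show ?thesis
            by (rule mod_add_cancel_small[OF piece_lt[OF W(2) dD[OF k] S] piece_lt[OF W(1) dD[OF k] S]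
                  eq[unfolded X rest qT]])
        qed
      qed
    qed
    have count: "real (card (u d S ` {W' \<in> ?L. V k W' = V k W}))
        \<le> 2 powr (real F * (1 - erasure_prob Kw dw ds k) * N S - c * real n)"
      if k: "k < K" and W: "W \<in> ?L" and S: "S \<in> A k" for k W S
    proof (cases "k < Kw")
      case True
      then have S': "S \<in> P" "k \<in> S" using S by (auto simp: A_def)
      \<comment> \<open>All components of \<open>Y\<close> are fixed by the cache because
        \<open>k \<in> S\<close>; only the sum modulo \<open>qq S\<close> can vary.\<close>
      have "u d S ` {W' \<in> ?L. V k W' = V k W} \<subseteq> {..<qq S} \<times> {Y d W S}"
      proof (rule image_subsetI)
        fix W' assume "W' \<in> {W' \<in> ?L. V k W' = V k W}"
        then have W': "W' \<in> ?L" "V k W' = V k W" by auto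
        have "Y d W' S = Y d W S" unfolding Y_def
          by (rule restrict_ext) (use True W W' S' dD in \<open>auto intro!: known\<close>)
        then show "u d S W' \<in> {..<qq S} \<times> {Y d W S}" using qq0 by (simp add: u_def)
      qed
      then have "card (u d S ` {W' \<in> ?L. V k W' = V k W}) \<le> card ({..<qq S} \<times> {Y d W S})"
        by (intro card_mono) auto
      then have "real (card (u d S ` {W' \<in> ?L. V k W' = V k W})) \<le> real (qq S)" by simp
      also have "\<dots> \<le> 2 powr (real F * (1 - dw) * N S - c * real n)"
        using S' by (intro weak) auto
      finally show ?thesis using True by (simp add: erasure_prob_def)
    next
      case False
      then have S': "S \<in> P" using S by (auto simp: A_def)
      let ?Z = "{Kw..<K} \<rightarrow>\<^sub>E {..<q (card S)}"
      \<comment> \<open>For a strong receiver \<open>V\<close> is constant, so both the sum and the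
        \<open>Ks\<close> piggybacked pieces are unknown.\<close>
      have "u d S ` {W' \<in> ?L. V k W' = V k W} \<subseteq> {..<qq S} \<times> ?Z"
        using qq0 dD S' by (auto simp: u_def Y_def intro!: piece_lt)
      then have "card (u d S ` {W' \<in> ?L. V k W' = V k W}) \<le> card ({..<qq S} \<times> ?Z)"
        by (intro card_mono finite_cartesian_product finite_PiE) auto
      then have "card (u d S ` {W' \<in> ?L. V k W' = V k W}) \<le> qq S * q (card S) ^ Ks"
        by (simp add: card_cartesian_product card_PiE K_def)
      then have "real (card (u d S ` {W' \<in> ?L. V k W' = V k W})) \<le> real (qq S * q (card S) ^ Ks)"
        by (rule of_nat_mono)
      also have "\<dots> \<le> 2 powr (real F * (1 - ds) * N S - c * real n)"
        using S' by (rule strong)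
      finally show ?thesis using False by (simp add: erasure_prob_def)
    qed
    show ?thesis unfolding K_def
      by (rule random_coding[where u = "u d" and A = A and slot = slot and \<rho> = \<rho> and c = c, OF del finP _ lib])
        (use determined count slot \<rho> decay B in \<open>auto simp: A_def V_def K_def N_def\<close>)
  qed
  \<comment> \<open>The codes for the single demands are glued together: \<open>error_prob\<close>
    at \<open>d\<close> evaluates encoder and decoders only at \<open>d\<close>, and
    \<open>cache\<close> does not depend on \<open>d\<close>.\<close>
  have "\<exists>ed. valid_demand K D d \<longrightarrow> (\<forall>W\<in>?L. \<forall>\<tau><n. length (fst ed d W \<tau>) = F) \<and>
    error_prob Kw Ks dw ds D n R cache (fst ed) (snd ed) d \<le> real K * real (card P) * B" for d
    using code[of d] by (metis fst_conv snd_conv)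
  then obtain ed where ed: "\<And>d. valid_demand K D d \<Longrightarrow> (\<forall>W\<in>?L. \<forall>\<tau><n. length (fst (ed d) d W \<tau>) = F) \<and>
    error_prob Kw Ks dw ds D n R cache (fst (ed d)) (snd (ed d)) d \<le> real K * real (card P) * B"
    by metis
  let ?enc = "\<lambda>d. fst (ed d) d" and ?dec = "\<lambda>k d. snd (ed d) k d"
  have "cache i W \<in> {1..nat \<lfloor>2 powr (real n * M)\<rfloor>}" if "i < Kw" "W \<in> ?L" for i W
    unfolding cache_def by (rule subsetD[OF cemb(1)[OF that(1)] imageI[OF content[OF that(2)]]])
  then have "valid_code F Kw Ks D n R M cache ?enc"
    unfolding valid_code_def using ed by (auto simp: K_def)
  moreover have "error_prob Kw Ks dw ds D n R cache ?enc ?dec d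
    = error_prob Kw Ks dw ds D n R cache (fst (ed d)) (snd (ed d)) d" for d
    by (simp add: error_prob_def)
  ultimately show ?thesis using ed cardP by (intro exI[of _ cache] exI[of _ ?enc] exI[of _ ?dec]) simp
qed

section \<open>Rate allocations\<close>

text \<open>\<open>p s\<close> is the rate of each piece whose index set has size \<open>s\<close>, and \<open>T s\<close> is the fraction of
  channel uses spent on each job whose set has size \<open>s\<close>.\<close>

definition allocation ::
  "nat \<Rightarrow> nat \<Rightarrow> nat \<Rightarrow> real \<Rightarrow> real \<Rightarrow> nat \<Rightarrow> real \<Rightarrow> real \<Rightarrow> (nat \<Rightarrow> real) \<Rightarrow> (nat \<Rightarrow> real) \<Rightarrow> bool" where
  "allocation F Kw Ks dw ds D R M p T \<longleftrightarrow> (\<forall>s. 0 \<le> p s \<and> 0 \<le> T s) \<and>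
     (\<Sum>S\<in>Pow {..<Kw}. p (card S)) = R \<and>
     (\<forall>i<Kw. real D * (\<Sum>S\<in>{S\<in>Pow {..<Kw}. i \<in> S}. p (card S)) \<le> M) \<and> 0 \<le> M \<and>
     (\<Sum>S\<in>Pow {..<Kw}. T (card S)) \<le> 1 \<and>
     (\<forall>s<Kw. p s \<le> T (Suc s) * (real F * (1 - dw))) \<and>
     (\<forall>s\<le>Kw. (if s = 0 then 0 else p (s - 1)) + real Ks * p s \<le> T s * (real F * (1 - ds)))"

definition feasible :: "nat \<Rightarrow> nat \<Rightarrow> nat \<Rightarrow> real \<Rightarrow> real \<Rightarrow> nat \<Rightarrow> real \<Rightarrow> real \<Rightarrow> bool" where
  "feasible F Kw Ks dw ds D R M \<longleftrightarrow> (\<exists>p T. allocation F Kw Ks dw ds D R M p T)"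

section \<open>From allocations to codes\<close>

text \<open>All rates and time fractions are scaled by some \<open>\<theta> < 1\<close> with
  \<open>R' < \<theta> * R\<close>. The rate margin absorbs the rounding of the piece alphabets; the
  freed time gives every job a surplus that pays for the rounding of slots and for the slack
  \<open>c\<close> in the error exponent.\<close>

lemma feasible_imp_achievable:
  assumes F: "1 \<le> F" and del: "0 < ds" "ds \<le> dw" "dw < 1"
    and feas: "feasible F Kw Ks dw ds D R M" and R': "0 \<le> R'" "R' < R"
  shows "achievable F Kw Ks dw ds D R' M"
proof -
  define P where "P = Pow {..<Kw}"
  from feas obtain p T where alloc: "allocation F Kw Ks dw ds D R M p T" unfolding feasible_def by blast
  then have p: "0 \<le> p s" and T: "0 \<le> T s"
    and rate: "(\<Sum>S\<in>P. p (card S)) = R"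
    and mem: "i < Kw \<Longrightarrow> real D * (\<Sum>S\<in>{S\<in>P. i \<in> S}. p (card S)) \<le> M" "0 \<le> M"
    and time: "(\<Sum>S\<in>P. T (card S)) \<le> 1"
    and weak: "s < Kw \<Longrightarrow> p s \<le> T (Suc s) * (real F * (1 - dw))"
    and strong: "s \<le> Kw \<Longrightarrow>
      (if s = 0 then 0 else p (s - 1)) + real Ks * p s \<le> T s * (real F * (1 - ds))" for s i
    unfolding allocation_def P_def by blast+
  let ?K = "Kw + Ks"
  have finP: "finite P" and cardP: "card P = 2 ^ Kw" and neP: "P \<noteq> {}"
    unfolding P_def by (auto simp: card_Pow)
  \<comment> \<open>\<open>\<theta>\<close> is the midpoint of \<open>R' / R\<close> and 1. The
    freed time \<open>1 - \<theta>\<close> is split evenly over the \<open>2 ^ Kw\<close> jobs as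
    \<open>\<kappa>\<close>, and \<open>c\<close> is half of what \<open>\<kappa>\<close> yields at
    the capacity of a weak receiver.\<close>
  define \<theta> where "\<theta> = (R' / R + 1) / 2"
  have \<theta>: "0 < \<theta>" "\<theta> < 1" "R' < \<theta> * R"
    unfolding \<theta>_def using R' by (auto simp: field_simps add_pos_nonneg)
  define \<kappa> where "\<kappa> = (1 - \<theta>) / 2 ^ Kw"
  have \<kappa>: "0 < \<kappa>" using \<theta> by (simp add: \<kappa>_def)
  define c where "c = real F * (1 - dw) * \<kappa> / 2"
  have c: "0 < c" using F del \<kappa> by (simp add: c_def)
  have "\<forall>k. \<exists>\<rho> r. 0 < \<rho> \<and> \<rho> \<le> 1 \<and> 0 < r \<and> r < 1 \<and> (\<forall>n m. m \<le> n \<longrightarrow>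
    2 powr (\<rho> * (real F * (1 - erasure_prob Kw dw ds k) * real m - c * real n))
      * (erasure_prob Kw dw ds k + (1 - erasure_prob Kw dw ds k) * 2 powr (- (real F * \<rho>))) ^ m \<le> r ^ n)"
    using del c by (intro allI erasure_exponent) (auto simp: erasure_prob_def)
  then obtain \<rho> r where \<rho>: "\<And>k. 0 < \<rho> k" "\<And>k. \<rho> k \<le> 1" and r: "\<And>k. 0 < r k" "\<And>k. r k < 1"
    and decay: "\<And>k n m. m \<le> n \<Longrightarrow> 2 powr (\<rho> k * (real F * (1 - erasure_prob Kw dw ds k) * real m - c * real n))
      * (erasure_prob Kw dw ds k + (1 - erasure_prob Kw dw ds k) * 2 powr (- (real F * \<rho> k))) ^ m \<le> r k ^ n"
    by metis
  \<comment> \<open>One bound for all receivers at once: it dominates each \<open>r k ^ n\<close>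
    and still tends to 0.\<close>
  define b where "b n = (\<Sum>k<?K. r k ^ n)" for n
  have "b \<longlonglongrightarrow> (\<Sum>k<?K. 0)" unfolding b_def
    using r by (intro tendsto_sum LIMSEQ_realpow_zero) (auto intro: less_imp_le)
  then have lim: "(\<lambda>n. real ?K * real (2 ^ Kw) * b n) \<longlonglongrightarrow> 0"
    by (auto intro: tendsto_mult_right_zero)
  \<comment> \<open>Rounding costs at most one bit for each of the \<open>2 ^ Kw\<close> pieces and
    at most one slot per job, worth at most \<open>F * (1 - ds)\<close> bits. The two conditions on
    \<open>n\<close> cover these losses.\<close>
  have codes: "\<exists>cache enc dec. valid_code F Kw Ks D n R' M cache enc \<and>
    (\<forall>d. valid_demand ?K D d \<longrightarrow> error_prob Kw Ks dw ds D n R' cache enc dec d \<le> real ?K * real (2 ^ Kw) * b n)"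
    if n1: "2 ^ Kw \<le> real n * (\<theta> * R - R')" and n2: "real F * (1 - ds) \<le> c * real n" for n
  proof -
    define q where "q s = nat \<lfloor>2 powr (real n * (\<theta> * p s))\<rfloor>" for s
    have ge1: "1 \<le> 2 powr (real n * (\<theta> * p s))" for s
      using p[of s] \<theta> by (intro ge_one_powr_ge_zero) auto
    have q1: "1 \<le> q s" for s using ge1[of s] unfolding q_def by linarith
    have q_le: "real (q s) \<le> 2 powr (real n * (\<theta> * p s))" for s
      using ge1[of s] unfolding q_def by linarith
    \<comment> \<open>Rounding down a number that is at least 1 at most halves it.\<close>
    have q_ge: "2 powr (real n * (\<theta> * p s) - 1) \<le> real (q s)" for s
    proof -
      have "2 powr (real n * (\<theta> * p s)) < real (q s) + 1"
        using ge1[of s] unfolding q_def by linarith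
      then have "2 powr (real n * (\<theta> * p s)) \<le> 2 * real (q s)" using q1[of s] by linarith
      then show ?thesis by (simp add: powr_diff)
    qed
    define m where "m S = nat \<lfloor>(\<theta> * T (card S) + \<kappa>) * real n\<rfloor>" for S :: "nat set"
    have \<sigma>: "0 \<le> (\<theta> * T s + \<kappa>) * real n" for s
      using T[of s] \<theta> \<kappa> by (intro mult_nonneg_nonneg add_nonneg_nonneg) auto
    have m_ge: "(\<theta> * T (card S) + \<kappa>) * real n - 1 \<le> real (m S)" for S
      using \<sigma>[of "card S"] unfolding m_def by linarith
    have m_le: "real (m S) \<le> (\<theta> * T (card S) + \<kappa>) * real n" for S
      using \<sigma>[of "card S"] unfolding m_def by linarith
    have "real (\<Sum>S\<in>P. m S) \<le> (\<Sum>S\<in>P. (\<theta> * T (card S) + \<kappa>) * real n)"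
      unfolding of_nat_sum by (intro sum_mono m_le)
    also have "\<dots> = (\<theta> * (\<Sum>S\<in>P. T (card S)) + (1 - \<theta>)) * real n"
      by (simp add: sum.distrib cardP \<kappa>_def flip: sum_distrib_right sum_distrib_left)
    also have "\<dots> \<le> 1 * real n"
      using time \<theta> by (intro mult_right_mono) (auto simp: mult_left_le)
    finally have "(\<Sum>S\<in>P. m S) \<le> n" by linarith
    from slot_allocation[OF finP neP this] obtain slot where slot: "\<forall>\<tau>. slot \<tau> \<in> P"
      "\<forall>S\<in>P. m S \<le> card {\<tau>\<in>{..<n}. slot \<tau> = S}" by blast
    let ?N = "\<lambda>S. real (card {\<tau>\<in>{..<n}. slot \<tau> = S})"
    \<comment> \<open>\<open>\<kappa>\<close> gains at least \<open>2 * (c * n)\<close>: one half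
      covers the slot lost by rounding, the other remains as slack.\<close>
    have budget: "real n * (\<theta> * x) \<le> real F * (1 - \<delta>) * ?N S - c * real n"
      if S: "S \<in> P" and x: "x \<le> T (card S) * (real F * (1 - \<delta>))" and \<delta>: "ds \<le> \<delta>" "\<delta> \<le> dw" for S x \<delta>
    proof -
      let ?f = "real F * (1 - \<delta>)"
      have f0: "0 \<le> ?f" using \<delta> del by simp
      have "m S \<le> card {\<tau>\<in>{..<n}. slot \<tau> = S}" using slot(2) S by blast
      then have "(\<theta> * T (card S) + \<kappa>) * real n - 1 \<le> ?N S" using m_ge[of S] by linarith
      then have "?f * ((\<theta> * T (card S) + \<kappa>) * real n - 1) \<le> ?f * ?N S"
        using f0 by (rule mult_left_mono)
      moreover have "\<theta> * real n * x \<le> \<theta> * real n * (T (card S) * ?f)"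
        using x \<theta> by (intro mult_left_mono) auto
      moreover have "real F * (1 - dw) * (\<kappa> * real n) \<le> ?f * (\<kappa> * real n)"
        using \<delta> \<kappa> by (intro mult_right_mono mult_left_mono) auto
      moreover have "real F * (1 - dw) * (\<kappa> * real n) = 2 * (c * real n)" by (simp add: c_def)
      moreover have "?f \<le> real F * (1 - ds)" using \<delta> by (intro mult_left_mono) auto
      ultimately show ?thesis using n2 by (simp add: algebra_simps)
    qed
    have cardS: "card S \<le> Kw" if "S \<in> P" for S
      using that card_mono[of "{..<Kw}" S] by (auto simp: P_def)
    have card0: "card S \<noteq> 0" if "S \<in> P" "S \<noteq> {}" for S
      using that by (auto simp: P_def card_eq_0_iff dest: finite_subset)
    show ?thesis
    proof (rule coded_caching_code[where Kw = Kw and q = q and slot = slot and \<rho> = \<rho> and c = c, folded P_def, OF del R'(1) q1])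
      have "real (msg_size n R') \<le> 2 powr (real n * R')"
        unfolding msg_size_def by (simp add: of_nat_nat)
      also have "\<dots> \<le> 2 powr (\<Sum>S\<in>P. real n * (\<theta> * p (card S)) - 1)"
        using n1 rate by (intro powr_mono)
          (auto simp: sum_subtractf cardP algebra_simps simp flip: sum_distrib_left)
      also have "\<dots> = (\<Prod>S\<in>P. 2 powr (real n * (\<theta> * p (card S)) - 1))"
        using finP by (simp add: powr_sum)
      also have "\<dots> \<le> (\<Prod>S\<in>P. real (q (card S)))" by (intro prod_mono) (auto intro: q_ge)
      finally show "msg_size n R' \<le> (\<Prod>S\<in>P. q (card S))" by (simp flip: of_nat_prod)
    next
      fix i assume i: "i < Kw"
      let ?Q = "{S\<in>P. i \<in> S}"
      have "real ((\<Prod>S\<in>?Q. q (card S)) ^ D) = (\<Prod>S\<in>?Q. real (q (card S))) ^ D" by simp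
      also have "\<dots> \<le> (\<Prod>S\<in>?Q. 2 powr (real n * (\<theta> * p (card S)))) ^ D"
        by (intro power_mono prod_mono prod_nonneg) (auto intro: q_le)
      also have "\<dots> = (2 powr (\<Sum>S\<in>?Q. real n * (\<theta> * p (card S)))) ^ D"
        using finP by (simp add: powr_sum)
      also have "\<dots> = 2 powr (real n * (\<theta> * (real D * (\<Sum>S\<in>?Q. p (card S)))))"
        by (simp add: powr_power sum_distrib_left mult_ac)
      also have "\<dots> \<le> 2 powr (real n * M)"
      proof (intro powr_mono mult_left_mono)
        have "\<theta> * (real D * (\<Sum>S\<in>?Q. p (card S))) \<le> \<theta> * M"
          using mem(1)[OF i] \<theta> by (intro mult_left_mono) auto
        also have "\<dots> \<le> M" using \<theta> mem(2) by (simp add: mult_left_le_one_le)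
        finally show "\<theta> * (real D * (\<Sum>S\<in>?Q. p (card S))) \<le> M" .
      qed auto
      finally show "(\<Prod>S\<in>?Q. q (card S)) ^ D \<le> nat \<lfloor>2 powr (real n * M)\<rfloor>" by (simp add: le_nat_floor)
    next
      fix \<tau> show "slot \<tau> \<in> P" using slot(1) by blast
    next
      fix S assume S: "S \<in> P" "S \<noteq> {}"
      have "real (q (card S - 1)) \<le> 2 powr (real n * (\<theta> * p (card S - 1)))" by (rule q_le)
      also have "\<dots> \<le> 2 powr (real F * (1 - dw) * ?N S - c * real n)"
        using weak[of "card S - 1"] cardS[OF S(1)] card0[OF S] S del by (intro powr_mono budget) auto
      finally show "real (if S = {} then 1 else q (card S - 1)) \<le> 2 powr (real F * (1 - dw) * ?N S - c * real n)"
        using S by simp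
    next
      fix S assume S: "S \<in> P"
      have "real (if S = {} then 1 else q (card S - 1)) \<le> 2 powr (real n * (\<theta> * (if card S = 0 then 0 else p (card S - 1))))"
        using q_le card0[OF S] by (cases "S = {}") auto
      moreover have "real (q (card S)) ^ Ks \<le> (2 powr (real n * (\<theta> * p (card S)))) ^ Ks"
        by (intro power_mono q_le) auto
      ultimately have "real ((if S = {} then 1 else q (card S - 1)) * q (card S) ^ Ks)
        \<le> 2 powr (real n * (\<theta> * (if card S = 0 then 0 else p (card S - 1)))) * (2 powr (real n * (\<theta> * p (card S)))) ^ Ks"
        unfolding of_nat_mult of_nat_power by (intro mult_mono) auto
      also have "\<dots> = 2 powr (real n * (\<theta> * ((if card S = 0 then 0 else p (card S - 1)) + real Ks * p (card S))))"
        by (simp add: powr_power powr_add[symmetric] algebra_simps)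
      also have "\<dots> \<le> 2 powr (real F * (1 - ds) * ?N S - c * real n)"
        using strong[OF cardS[OF S]] S del by (intro powr_mono budget) auto
      finally show "real ((if S = {} then 1 else q (card S - 1)) * q (card S) ^ Ks)
        \<le> 2 powr (real F * (1 - ds) * ?N S - c * real n)" .
    next
      fix k assume k: "k < ?K"
      have "r k ^ n \<le> b n" unfolding b_def
        by (rule member_le_sum) (use k r(1) in \<open>auto intro: less_imp_le\<close>)
      then show "\<forall>m\<le>n. 2 powr (\<rho> k * (real F * (1 - erasure_prob Kw dw ds k) * real m - c * real n))
        * (erasure_prob Kw dw ds k + (1 - erasure_prob Kw dw ds k) * 2 powr (- (real F * \<rho> k))) ^ m \<le> b n"
        using decay order_trans by blast
    next
      show "0 \<le> b n" unfolding b_def by (intro sum_nonneg zero_le_power less_imp_le r(1))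
    qed (use \<rho> in auto)
  qed
  have "\<exists>N. \<forall>n\<ge>N. \<exists>cache enc dec. valid_code F Kw Ks D n R' M cache enc \<and>
    (\<forall>d. valid_demand ?K D d \<longrightarrow> error_prob Kw Ks dw ds D n R' cache enc dec d \<le> \<epsilon>)" if "\<epsilon> > 0" for \<epsilon>
  proof -
    have "eventually (\<lambda>n. real ?K * real (2 ^ Kw) * b n < \<epsilon>) sequentially"
      using order_tendstoD(2)[OF lim that] .
    moreover have "filterlim (\<lambda>n. real n * (\<theta> * R - R')) at_top sequentially"
      using \<theta>(3) by (intro filterlim_at_top_mult_tendsto_pos[OF tendsto_const _ filterlim_real_sequentially]) auto
    then have "eventually (\<lambda>n. 2 ^ Kw \<le> real n * (\<theta> * R - R')) sequentially"
      by (simp add: filterlim_at_top)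
    moreover have "filterlim (\<lambda>n. c * real n) at_top sequentially"
      using c by (intro filterlim_tendsto_pos_mult_at_top[OF tendsto_const _ filterlim_real_sequentially]) auto
    then have "eventually (\<lambda>n. real F * (1 - ds) \<le> c * real n) sequentially"
      by (simp add: filterlim_at_top)
    ultimately have "eventually (\<lambda>n. \<exists>cache enc dec. valid_code F Kw Ks D n R' M cache enc \<and>
      (\<forall>d. valid_demand ?K D d \<longrightarrow> error_prob Kw Ks dw ds D n R' cache enc dec d \<le> \<epsilon>)) sequentially"
    proof eventually_elim
      case (elim n)
      from codes[OF elim(2,3)] obtain cache enc dec where
        "valid_code F Kw Ks D n R' M cache enc"
        "\<forall>d. valid_demand ?K D d \<longrightarrow> error_prob Kw Ks dw ds D n R' cache enc dec d \<le> real ?K * real (2 ^ Kw) * b n"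
        by blast
      then show ?case using elim(1) by (meson less_imp_le order_trans)
    qed
    then show ?thesis by (simp add: eventually_sequentially)
  qed
  then show ?thesis using R' by (simp add: achievable_def)
qed

section \<open>Convexity of the feasible region\<close>

text \<open>Every condition of \<open>allocation\<close> is linear in \<open>p\<close>,
  \<open>T\<close>, \<open>R\<close> and \<open>M\<close> jointly, so the same combination of the
  witnesses works.\<close>

lemma feasible_convex_combination:
  assumes feas: "\<And>t. t \<in> I \<Longrightarrow> feasible F Kw Ks dw ds D (Rs t) (Ms t)"
    and l: "\<And>t. t \<in> I \<Longrightarrow> 0 \<le> l t" "(\<Sum>t\<in>I. l t) = 1"
  shows "feasible F Kw Ks dw ds D (\<Sum>t\<in>I. l t * Rs t) (\<Sum>t\<in>I. l t * Ms t)"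
proof -
  from feas obtain p T where alloc: "\<And>t. t \<in> I \<Longrightarrow> allocation F Kw Ks dw ds D (Rs t) (Ms t) (p t) (T t)"
    unfolding feasible_def by metis
  have nonneg: "0 \<le> p t s" "0 \<le> T t s"
    and rate: "(\<Sum>S\<in>Pow {..<Kw}. p t (card S)) = Rs t"
    and mem: "i < Kw \<Longrightarrow> real D * (\<Sum>S\<in>{S\<in>Pow {..<Kw}. i \<in> S}. p t (card S)) \<le> Ms t" "0 \<le> Ms t"
    and time: "(\<Sum>S\<in>Pow {..<Kw}. T t (card S)) \<le> 1"
    and weak: "s < Kw \<Longrightarrow> p t s \<le> T t (Suc s) * (real F * (1 - dw))"
    and strong: "s \<le> Kw \<Longrightarrow>
      (if s = 0 then 0 else p t (s - 1)) + real Ks * p t s \<le> T t s * (real F * (1 - ds))"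
    if "t \<in> I" for t s i
    using alloc[OF that] unfolding allocation_def by blast+
  let ?p = "\<lambda>s. \<Sum>t\<in>I. l t * p t s" and ?T = "\<lambda>s. \<Sum>t\<in>I. l t * T t s"
  have swap: "(\<Sum>S\<in>A. \<Sum>t\<in>I. l t * f t (card S)) = (\<Sum>t\<in>I. l t * (\<Sum>S\<in>A. f t (card S)))"
    for A :: "nat set set" and f :: "_ \<Rightarrow> nat \<Rightarrow> real"
    by (subst sum.swap) (simp add: sum_distrib_left)
  have "(\<Sum>S\<in>Pow {..<Kw}. ?p (card S)) = (\<Sum>t\<in>I. l t * Rs t)" unfolding swap using rate by simp
  moreover have "real D * (\<Sum>S\<in>{S\<in>Pow {..<Kw}. i \<in> S}. ?p (card S)) \<le> (\<Sum>t\<in>I. l t * Ms t)" if "i < Kw" for i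
  proof -
    have "real D * (\<Sum>S\<in>{S\<in>Pow {..<Kw}. i \<in> S}. ?p (card S))
      = (\<Sum>t\<in>I. l t * (real D * (\<Sum>S\<in>{S\<in>Pow {..<Kw}. i \<in> S}. p t (card S))))"
      unfolding swap by (simp add: sum_distrib_left mult.left_commute)
    also have "\<dots> \<le> (\<Sum>t\<in>I. l t * Ms t)" using mem(1) that l by (intro sum_mono mult_left_mono) auto
    finally show ?thesis .
  qed
  moreover have "0 \<le> (\<Sum>t\<in>I. l t * Ms t)" using l mem(2) by (intro sum_nonneg) auto
  moreover have "(\<Sum>S\<in>Pow {..<Kw}. ?T (card S)) \<le> 1"
  proof -
    have "(\<Sum>S\<in>Pow {..<Kw}. ?T (card S)) \<le> (\<Sum>t\<in>I. l t * 1)"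
      unfolding swap using time l by (intro sum_mono mult_left_mono) auto
    then show ?thesis using l by simp
  qed
  moreover have "?p s \<le> ?T (Suc s) * (real F * (1 - dw))" if "s < Kw" for s
    unfolding sum_distrib_right mult.assoc using weak that l by (intro sum_mono mult_left_mono) auto
  moreover have "(if s = 0 then 0 else ?p (s - 1)) + real Ks * ?p s \<le> ?T s * (real F * (1 - ds))" if "s \<le> Kw" for s
  proof -
    have "(if s = 0 then 0 else ?p (s - 1)) + real Ks * ?p s
      = (\<Sum>t\<in>I. l t * ((if s = 0 then 0 else p t (s - 1)) + real Ks * p t s))"
      by (simp add: sum.distrib sum_distrib_left distrib_left mult.left_commute)
    also have "\<dots> \<le> ?T s * (real F * (1 - ds))"
      unfolding sum_distrib_right mult.assoc using strong[OF _ that] l by (intro sum_mono mult_left_mono) auto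
    finally show ?thesis .
  qed
  moreover have "0 \<le> ?p s" "0 \<le> ?T s" for s using l nonneg by (auto intro!: sum_nonneg)
  ultimately show ?thesis unfolding feasible_def allocation_def by (intro exI[of _ ?p] exI[of _ ?T]) auto
qed

section \<open>Corner points\<close>

lemma Suc_times_choose_Suc: "Suc k * (n choose Suc k) = (n - k) * (n choose k)"
  by (metis binomial_absorb_comp binomial_absorption)

lemma sum_Pow_level:
  assumes "finite A"
  shows "(\<Sum>S\<in>Pow A. if card S = v then \<alpha> else 0) = real (card A choose v) * (\<alpha> :: real)"
proof -
  have "(\<Sum>S\<in>Pow A. if card S = v then \<alpha> else 0) = (\<Sum>S\<in>{S. S \<subseteq> A \<and> card S = v}. \<alpha>)"
    by (rule sum.mono_neutral_cong_right) (use assms in auto)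
  then show ?thesis using n_subsets[OF assms, of v] by simp
qed

text \<open>Removing \<open>i\<close> maps the \<open>v\<close>-subsets through \<open>i\<close>
  bijectively to the subsets of \<open>A - {i}\<close> with one element less; absorption turns their
  number into the share \<open>v / card A\<close> of all \<open>v\<close>-subsets.\<close>

lemma sum_Pow_level_containing:
  assumes fin: "finite A" and i: "i \<in> A"
  shows "(\<Sum>S\<in>{S\<in>Pow A. i \<in> S}. if card S = v then \<alpha> else 0)
    = real v * real (card A choose v) / real (card A) * (\<alpha> :: real)"
proof -
  have fS: "finite S" if "S \<subseteq> A" for S using that fin finite_subset by blast
  have A0: "card A \<noteq> 0" using assms by auto
  have "(\<Sum>S\<in>{S\<in>Pow A. i \<in> S}. if card S = v then \<alpha> else 0) = (\<Sum>S\<in>{S. S \<subseteq> A \<and> i \<in> S \<and> card S = v}. \<alpha>)"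
    by (rule sum.mono_neutral_cong_right) (use fin in auto)
  also have "\<dots> = real (card {S. S \<subseteq> A \<and> i \<in> S \<and> card S = v}) * \<alpha>" by simp
  also have "real (card {S. S \<subseteq> A \<and> i \<in> S \<and> card S = v}) = real v * real (card A choose v) / real (card A)"
  proof (cases v)
    case 0
    then have "{S. S \<subseteq> A \<and> i \<in> S \<and> card S = v} = {}" using fS by (auto simp: card_eq_0_iff)
    then show ?thesis unfolding 0 by (simp only: card.empty of_nat_0 mult_zero_left div_0)
  next
    case (Suc w)
    let ?B = "{B. B \<subseteq> A - {i} \<and> card B = w}"
    have "{S. S \<subseteq> A \<and> i \<in> S \<and> card S = v} = insert i ` ?B"
    proof (intro equalityI subsetI)
      fix S assume S: "S \<in> {S. S \<subseteq> A \<and> i \<in> S \<and> card S = v}"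
      then have "S - {i} \<in> ?B" "S = insert i (S - {i})" using Suc fS[of S] by auto
      then show "S \<in> insert i ` ?B" by blast
    next
      fix S assume "S \<in> insert i ` ?B"
      then obtain B where B: "B \<subseteq> A - {i}" "card B = w" "S = insert i B" by auto
      then have "finite B" "i \<notin> B" using fS by auto
      then show "S \<in> {S. S \<subseteq> A \<and> i \<in> S \<and> card S = v}" using B i Suc by auto
    qed
    moreover have "inj_on (insert i) ?B" by (intro inj_onI) blast
    ultimately have "card {S. S \<subseteq> A \<and> i \<in> S \<and> card S = v} = card ?B" by (simp add: card_image)
    also have "\<dots> = (card A - 1) choose w" using n_subsets[of "A - {i}" w] fin i by simp
    finally have c: "card {S. S \<subseteq> A \<and> i \<in> S \<and> card S = v} = (card A - 1) choose w" .
    have "v * (card A choose v) = card A * ((card A - 1) choose w)"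
      unfolding Suc by (rule binomial_absorption)
    then have "real v * real (card A choose v) = real (card A) * real ((card A - 1) choose w)"
      by (simp only: flip: of_nat_mult)
    then show ?thesis unfolding c using A0 by (simp add: field_simps)
  qed
  finally show ?thesis .
qed

section \<open>Allocations for the corner points\<close>

text \<open>Pieces of size \<open>v\<close> get rate \<open>x\<close>, pieces of size
  \<open>Suc v\<close> rate \<open>y\<close>. Jobs of size \<open>v\<close> serve only strong
  receivers. In jobs of size \<open>Suc v\<close> the weak receivers need time for sums of rate
  \<open>x\<close>, and the third condition in \<open>xy\<close> says that the strong receivers'
  better channel has room for \<open>Ks\<close> pieces of rate \<open>y\<close> in that time. Jobs
  of size \<open>Suc (Suc v)\<close> carry only sums. The equation for \<open>M\<close> is
  restricted to \<open>Kw \<noteq> 0\<close>, because division by zero would otherwise force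
  \<open>M = 0\<close>.\<close>

lemma feasible_two_levels:
  fixes x y :: real
  assumes F: "1 \<le> F" and del: "0 < ds" "ds \<le> dw" "dw < 1"
    and xy: "0 \<le> x" "0 \<le> y" "real Ks * y * (1 - dw) \<le> x * (dw - ds)"
    and R: "R = real (Kw choose v) * x + real (Kw choose Suc v) * y"
    and M: "Kw \<noteq> 0 \<Longrightarrow> M = real D / real Kw * (real v * real (Kw choose v) * x + real (Suc v) * real (Kw choose Suc v) * y)"
      "0 \<le> M"
    and time: "real (Kw choose v) * (real Ks * x / (real F * (1 - ds))) + real (Kw choose Suc v) * (x / (real F * (1 - dw)))
      + real (Kw choose Suc (Suc v)) * (y / (real F * (1 - dw))) \<le> 1"
  shows "feasible F Kw Ks dw ds D R M"
proof -
  define p where "p s = (if s = v then x else 0) + (if s = Suc v then y else 0)" for s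
  define T where "T s = (if s = v then real Ks * x / (real F * (1 - ds)) else 0)
    + (if s = Suc v then x / (real F * (1 - dw)) else 0) + (if s = Suc (Suc v) then y / (real F * (1 - dw)) else 0)" for s
  have Fw: "0 < real F * (1 - dw)" and Fs: "0 < real F * (1 - ds)" using F del by auto
  have key: "x + real Ks * y \<le> x / (real F * (1 - dw)) * (real F * (1 - ds))"
  proof -
    have "(x + real Ks * y) * (1 - dw) \<le> x * (1 - ds)" using xy by (simp add: algebra_simps)
    then have "x + real Ks * y \<le> x * (1 - ds) / (1 - dw)" using del by (simp add: pos_le_divide_eq)
    also have "\<dots> = x / (real F * (1 - dw)) * (real F * (1 - ds))" using F by simp
    finally show ?thesis .
  qed
  have y_le: "y \<le> y / (real F * (1 - dw)) * (real F * (1 - ds))"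
    using F del xy by (simp add: pos_le_divide_eq mult_left_mono)
  have "(\<Sum>S\<in>Pow {..<Kw}. p (card S)) = R" unfolding p_def R by (simp add: sum.distrib sum_Pow_level)
  moreover have "real D * (\<Sum>S\<in>{S\<in>Pow {..<Kw}. i \<in> S}. p (card S)) \<le> M" if "i < Kw" for i
  proof -
    have "real D * (\<Sum>S\<in>{S\<in>Pow {..<Kw}. i \<in> S}. p (card S)) = M"
      using that unfolding p_def M(1)[OF gr_implies_not0[OF that]] sum.distrib
      by (subst (1 2) sum_Pow_level_containing) (auto simp: algebra_simps add_divide_distrib)
    then show ?thesis by simp
  qed
  moreover have "(\<Sum>S\<in>Pow {..<Kw}. T (card S)) \<le> 1"
    using time unfolding T_def by (simp add: sum.distrib sum_Pow_level)
  moreover have "p s \<le> T (Suc s) * (real F * (1 - dw))" if "s < Kw" for s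
    using Fw xy Fs unfolding p_def T_def by auto
  moreover have "(if s = 0 then 0 else p (s - 1)) + real Ks * p s \<le> T s * (real F * (1 - ds))" if "s \<le> Kw" for s
  proof -
    consider "s = v" | "s = Suc v" | "s = Suc (Suc v)" | "s \<notin> {v, Suc v, Suc (Suc v)}" by blast
    then show ?thesis
    proof cases
      case 1
      then have "p (s - 1) = 0" if "s \<noteq> 0" using that unfolding p_def by auto
      then show ?thesis using 1 Fs by (auto simp: p_def T_def)
    qed (use key y_le in \<open>auto simp: p_def T_def\<close>)
  qed
  moreover have "0 \<le> p s" "0 \<le> T s" for s using xy Fw Fs by (auto simp: p_def T_def)
  ultimately show ?thesis unfolding feasible_def allocation_def using M(2) by (intro exI[of _ p] exI[of _ T]) auto
qed

text \<open>\<open>a\<close> is the total rate of the pieces of size \<open>t - 1\<close> and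
  \<open>\<xi> * a\<close> that of the pieces of size \<open>t\<close>. \<open>\<xi>\<close> makes
  the piggybacked pieces exactly fill the room left in the jobs of size \<open>t\<close>, and
  \<open>Q\<close> normalises the total time to 1.\<close>

lemma feasible_corner_point:
  assumes F: "1 \<le> F" and Ks: "1 \<le> Ks" and del: "0 < ds" "ds \<le> dw" "dw < 1" and t: "1 \<le> t" "t \<le> Kw"
  shows "0 < Rpt F Kw Ks dw ds t"
    and "feasible F Kw Ks dw ds D (Rpt F Kw Ks dw ds t) (Mpt F Kw Ks dw ds D t)"
proof -
  define g where "g = (dw - ds) / (1 - dw)"
  \<comment> \<open>\<open>A1\<close> and \<open>A2\<close> are the ratios of consecutive binomials
    \<open>Kw choose s\<close> for \<open>s\<close> equal to \<open>t - 1\<close>, \<open>t\<close>,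
    \<open>t + 1\<close>.\<close>
  define A1 where "A1 = (real Kw - real t + 1) / real t"
  define A2 where "A2 = (real Kw - real t) / (real t + 1)"
  define \<xi> where "\<xi> = A1 / real Ks * g"
  define Q where "Q = A1 * (1 + A2 / real Ks * g) + real Ks * (1 - dw) / (1 - ds)"
  define a where "a = real F * (1 - dw) / Q"
  have g0: "0 \<le> g" using del by (simp add: g_def)
  have A0: "0 < A1" "0 \<le> A2" using t by (auto simp: A1_def A2_def)
  have \<xi>0: "0 \<le> \<xi>" using A0 g0 by (simp add: \<xi>_def)
  have "0 \<le> A1 * (1 + A2 / real Ks * g)" using A0 g0 by simp
  moreover have "0 < real Ks * (1 - dw) / (1 - ds)" using Ks del by simp
  ultimately have Q0: "0 < Q" unfolding Q_def by linarith
  have a0: "0 < a" using F del Q0 by (simp add: a_def)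
  have R: "Rpt F Kw Ks dw ds t = a * (1 + \<xi>)"
    using t unfolding Rpt_def a_def Q_def \<xi>_def A1_def A2_def g_def by (simp add: Let_def mult_ac)
  show "0 < Rpt F Kw Ks dw ds t" unfolding R using a0 \<xi>0 by simp
  have M: "Mpt F Kw Ks dw ds D t = real D / real Kw * ((real t - 1) * a + real t * (\<xi> * a))"
  proof -
    have "Mpt F Kw Ks dw ds D t = a * (1 + \<xi>) * real D / real Kw * (real t - 1 / (1 + \<xi>))"
      using t unfolding Mpt_def R \<xi>_def A1_def g_def by (simp add: Let_def mult_ac)
    also have "\<dots> = real D / real Kw * (a * ((1 + \<xi>) * (real t - 1 / (1 + \<xi>))))" by simp
    also have "(1 + \<xi>) * (real t - 1 / (1 + \<xi>)) = (1 + \<xi>) * real t - 1"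
      using \<xi>0 by (simp add: right_diff_distrib)
    finally show ?thesis by (simp add: algebra_simps)
  qed
  obtain v where v: "t = Suc v" using t by (cases t) auto
  let ?c = "\<lambda>s. real (Kw choose s)"
  have c0: "0 < ?c v" "0 < ?c t" using t v by auto
  have "real (Suc s * (Kw choose Suc s)) = real ((Kw - s) * (Kw choose s))" for s
    by (simp only: Suc_times_choose_Suc)
  then have step: "real (Suc s) * ?c (Suc s) = real (Kw - s) * ?c s" for s
    by (simp only: of_nat_mult)
  have c1: "?c t = A1 * ?c v"
    using step[of v] t unfolding A1_def v by (simp add: field_simps of_nat_diff)
  have c2: "?c (Suc t) = A2 * ?c t"
    using step[of t] t unfolding A2_def by (simp add: field_simps of_nat_diff)
  define x where "x = a / ?c v"
  define y where "y = \<xi> * a / ?c t"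
  have cx: "?c v * x = a" and cy: "?c t * y = \<xi> * a" using c0 by (auto simp: x_def y_def)
  have tx: "?c t * x = A1 * a" unfolding c1 using cx by simp
  have sy: "?c (Suc t) * y = A2 * (\<xi> * a)" unfolding c2 using cy by simp
  show "feasible F Kw Ks dw ds D (Rpt F Kw Ks dw ds t) (Mpt F Kw Ks dw ds D t)"
  proof (rule feasible_two_levels[OF F del, where v = v and x = x and y = y])
    show "0 \<le> x" "0 \<le> y" unfolding x_def y_def using a0 \<xi>0 by auto
    have "real Ks * y = x * g"
      unfolding x_def y_def c1 \<xi>_def using A0 Ks by simp
    then have "real Ks * y * (1 - dw) = x * (g * (1 - dw))" by simp
    also have "g * (1 - dw) = dw - ds" unfolding g_def using del by simp
    finally show "real Ks * y * (1 - dw) \<le> x * (dw - ds)" by simp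
    show "Rpt F Kw Ks dw ds t = ?c v * x + ?c (Suc v) * y"
      using R cx cy v by (simp add: algebra_simps)
    show "Mpt F Kw Ks dw ds D t = real D / real Kw * (real v * ?c v * x + real (Suc v) * ?c (Suc v) * y)"
      unfolding M using cx cy v by (simp only: mult.assoc) simp
    show "0 \<le> Mpt F Kw Ks dw ds D t" unfolding M using a0 \<xi>0 t by simp
    have "?c v * (real Ks * x / (real F * (1 - ds))) + ?c (Suc v) * (x / (real F * (1 - dw)))
        + ?c (Suc (Suc v)) * (y / (real F * (1 - dw)))
      = real Ks * (?c v * x) / (real F * (1 - ds)) + (?c t * x + ?c (Suc t) * y) / (real F * (1 - dw))"
      unfolding v by (simp add: add_divide_distrib)
    also have "\<dots> = a * (real Ks / (real F * (1 - ds)) + (A1 + A2 * \<xi>) / (real F * (1 - dw)))"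
      unfolding cx tx sy by (simp add: add_divide_distrib algebra_simps)
    \<comment> \<open>\<open>Q / (F * (1 - dw))\<close> is the time spent per unit of
      \<open>a\<close>, and \<open>a\<close> is its reciprocal.\<close>
    also have "\<dots> = a * (Q / (real F * (1 - dw)))"
    proof -
      have "real Ks * (1 - dw) / (1 - ds) / (real F * (1 - dw)) = real Ks / (real F * (1 - ds))"
        using del by (simp add: mult.commute)
      moreover have "A1 * (1 + A2 / real Ks * g) = A1 + A2 * \<xi>" by (simp add: \<xi>_def algebra_simps)
      ultimately show ?thesis unfolding Q_def by (simp add: add_divide_distrib)
    qed
    also have "\<dots> = 1" unfolding a_def using F del Q0 by simp
    finally show "?c v * (real Ks * x / (real F * (1 - ds))) + ?c (Suc v) * (x / (real F * (1 - dw)))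
        + ?c (Suc (Suc v)) * (y / (real F * (1 - dw))) \<le> 1" by simp
  qed
qed

text \<open>The whole message is the piece with index \<open>{}\<close>, which nobody caches. The
  job \<open>{}\<close> serves the strong receivers, and each singleton job serves one weak receiver
  by a sum with one term.\<close>

lemma feasible_no_cache_point:
  assumes F: "1 \<le> F" and Ks: "1 \<le> Ks" and del: "0 < ds" "ds \<le> dw" "dw < 1"
  shows "0 < Rpt F Kw Ks dw ds 0"
    and "feasible F Kw Ks dw ds D (Rpt F Kw Ks dw ds 0) (Mpt F Kw Ks dw ds D 0)"
proof -
  let ?R = "Rpt F Kw Ks dw ds 0"
  define Q where "Q = real Kw / (1 - dw) + real Ks / (1 - ds)"
  have Q0: "0 < Q" unfolding Q_def using Ks del by (intro add_nonneg_pos) auto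
  have R: "?R = real F / Q" by (simp add: Rpt_def Q_def)
  show R0: "0 < ?R" unfolding R using F Q0 by simp
  have "real Ks * ?R / (real F * (1 - ds)) + real Kw * (?R / (real F * (1 - dw))) = ?R * (Q / real F)"
    unfolding Q_def by (simp add: add_divide_distrib distrib_left mult_ac)
  also have "\<dots> = 1" unfolding R using F Q0 by simp
  finally show "feasible F Kw Ks dw ds D ?R (Mpt F Kw Ks dw ds D 0)"
    using R0 del by (intro feasible_two_levels[OF F del, where v = 0 and x = ?R and y = 0]) (auto simp: Mpt_def)
qed

text \<open>The whole message is the piece indexed by the set of all weak receivers. Each of them
  caches the full library, so the channel serves only the strong receivers.\<close>

lemma feasible_full_cache_point:
  assumes F: "1 \<le> F" and Ks: "1 \<le> Ks" and del: "0 < ds" "ds \<le> dw" "dw < 1"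
  shows "0 < Rpt F Kw Ks dw ds (Kw + 1)"
    and "feasible F Kw Ks dw ds D (Rpt F Kw Ks dw ds (Kw + 1)) (Mpt F Kw Ks dw ds D (Kw + 1))"
proof -
  let ?R = "Rpt F Kw Ks dw ds (Kw + 1)"
  have R: "?R = real F * (1 - ds) / real Ks" by (simp add: Rpt_def)
  show R0: "0 < ?R" unfolding R using F Ks del by simp
  have M: "Mpt F Kw Ks dw ds D (Kw + 1) = real D * ?R" unfolding R by (simp add: Mpt_def)
  have "real Ks * ?R / (real F * (1 - ds)) = 1" unfolding R using F Ks del by simp
  then show "feasible F Kw Ks dw ds D ?R (Mpt F Kw Ks dw ds D (Kw + 1))"
    unfolding M using R0 del
    by (intro feasible_two_levels[OF F del, where v = Kw and x = ?R and y = 0]) (auto simp: binomial_eq_0)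
qed

section \<open>From feasible points to the hull\<close>

theorem theorem1:
  fixes F Kw Ks D :: nat and dw ds M :: real
  assumes "1 \<le> F" and "1 \<le> Ks" and "0 < ds" and "ds \<le> dw" and "dw < 1"
    and "Kw + Ks \<le> D"
  shows "upper_convex_hull (Rpt F Kw Ks dw ds) (Mpt F Kw Ks dw ds D) (Kw + 1) M
           \<le> capacity_memory F Kw Ks dw ds D M"
  unfolding upper_convex_hull_def
proof (rule SUP_least)
  let ?I = "{..Kw + 1}" and ?Rs = "Rpt F Kw Ks dw ds" and ?Ms = "Mpt F Kw Ks dw ds D"
  fix l :: "nat \<Rightarrow> real"
  assume "l \<in> {l. (\<forall>t\<le>Kw + 1. 0 \<le> l t) \<and> (\<Sum>t\<le>Kw + 1. l t) = 1 \<and> (\<Sum>t\<le>Kw + 1. l t * ?Ms t) = M}"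
  then have l: "\<And>t. t \<in> ?I \<Longrightarrow> 0 \<le> l t" "(\<Sum>t\<in>?I. l t) = 1" and M: "(\<Sum>t\<in>?I. l t * ?Ms t) = M" by auto
  define R where "R = (\<Sum>t\<in>?I. l t * ?Rs t)"
  have point: "0 < ?Rs t \<and> feasible F Kw Ks dw ds D (?Rs t) (?Ms t)" if "t \<in> ?I" for t
  proof -
    have "t \<le> Kw + 1" using that by simp
    then consider "t = 0" | "1 \<le> t" "t \<le> Kw" | "t = Kw + 1" by linarith
    then show ?thesis
    proof cases
      case 1
      then show ?thesis using feasible_no_cache_point[OF assms(1-5)] by simp
    next
      case 2
      then show ?thesis using feasible_corner_point[OF assms(1-5)] by blast
    next
      case 3
      then show ?thesis using feasible_full_cache_point[OF assms(1-5)] by blast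
    qed
  qed
  have feas: "feasible F Kw Ks dw ds D R M"
    unfolding R_def M[symmetric] using point l by (intro feasible_convex_combination) auto
  \<comment> \<open>Positivity leaves room for a rate strictly between \<open>max z 0\<close> and
    \<open>R\<close>; \<open>achievable\<close> demands a nonnegative rate.\<close>
  have "R > 0"
  proof -
    obtain t where t: "t \<in> ?I" "l t \<noteq> 0" using l(2) by (metis sum.neutral zero_neq_one)
    then have "0 < l t * ?Rs t" using l(1)[OF t(1)] point[OF t(1)] by simp
    also have "\<dots> \<le> R" unfolding R_def
      by (rule member_le_sum) (use t l(1) point in \<open>simp_all add: less_imp_le\<close>)
    finally show ?thesis .
  qed
  show "ereal (\<Sum>t\<le>Kw + 1. l t * ?Rs t) \<le> capacity_memory F Kw Ks dw ds D M"
    unfolding R_def[symmetric]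
  \<comment> \<open>Codes are available for rates strictly below \<open>R\<close>, so the supremum
    is bounded below by density.\<close>
  proof (rule dense_le)
    fix z assume z: "z < ereal R"
    obtain R' where R': "max z 0 < ereal R'" "ereal R' < ereal R"
      using ereal_dense2[of "max z 0" "ereal R"] z \<open>R > 0\<close> by auto
    then have "0 \<le> R'" "R' < R" by auto
    then have "achievable F Kw Ks dw ds D R' M"
      by (intro feasible_imp_achievable[OF assms(1,3-5) feas])
    then have "ereal R' \<le> capacity_memory F Kw Ks dw ds D M"
      unfolding capacity_memory_def by (intro SUP_upper) simp
    then show "z \<le> capacity_memory F Kw Ks dw ds D M" using R'(1) by (meson less_imp_le max_less_iff_conj order_trans)
  qed
qed

end
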